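(* Let $p\ge 3$ be a prime, let $k\ge 1$ and $q\ge 2$ be integers with $|q|_p=1$, let $s\ge 0$ be the integer with $|q-1|_p=p^{-s}$, and let $\theta\in\mathcal E_p$, $\theta\ne 1$. Assume that $\sqrt[k]{1-q}\in\mathbb Q_p$ (i.e. there is $y\in\mathbb Q_p$ with $y^k=1-q$) and that $\kappa_p\ge 2$. Let $X$ be the set defined in the context. If $$|k|_p>p^{\frac{s(k-1)}{k}}\,|\theta-1|_p,$$ then the restriction of $f_\theta$ to its Julia set $J_{f_\theta}$ is conjugate to the full shift $(\Sigma,\sigma)$ on $\kappa_p$ symbols; that is, there is a homeomorphism $h:J_{f_\theta}\to\Sigma$ with $h\circ f_\theta=\sigma\circ h$ on $J_{f_\theta}$.
   Context: $\mathbb Q_p$ is the field of $p$-adic numbers with the $p$-adic norm $|\cdot|_p$. $\mathcal E_p=\{x\in\mathbb Q_p:|x-1|_p\le 1/p\}$ (for $p\ge3$). The Potts-Bethe mapping is $$f_\theta(x)=\left(\frac{\theta x+q-1}{x+\theta+q-2}\right)^k .$$ $B_r(a)=\{x\in\mathbb Q_p:|x-a|_p\le r\}$. Identify $\mathbb F_p$ with $\{0,1,\dots,p-1\}$. Define $\mathrm{Sol}_p(x^k+q-1)$ as the set of all $\xi\in\mathbb F_p$ with $(p^{s/k}\xi)^k+q-1\equiv 0\pmod{p^{s+1}}$ if $k\mid s$, and as the empty set if $k\nmid s$. When nonempty, write $\kappa_p=|\mathrm{Sol}_p(x^k+q-1)|$ and $\mathrm{Sol}_p(x^k+q-1)=\{\xi_1,\dots,\xi_{\kappa_p}\}$.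 The set $X$ is $$X=\bigcup_{i=1}^{\kappa_p}B_r(x_i),\qquad r=p^{-\frac{s+k}{k}}|\theta-1|_p,$$ a finite union of disjoint balls, where: if $s=0$, then $x_i=1-q+\eta_i(\theta-1)$ when $\xi_i+q-1\not\equiv0\pmod p$, with $\eta_i$ an integer satisfying $\eta_i(\xi_i-1)+\xi_i+q-1\equiv0\pmod p$, and $x_i=1-q$ when $\xi_i+q-1\equiv0\pmod p$; if $s>0$, then $x_i=1-q+p^{s/k}\xi_i(\theta-1)$. The Julia set of $f_\theta:X\to\mathbb Q_p$ is $J_{f_\theta}=\bigcap_{n\ge0}f_\theta^{-n}(X)$ (the points of $X$ all of whose iterates are in $X$). $\Sigma=\{1,\dots,\kappa_p\}^{\{0,1,2,\dots\}}$ carries the product topology and $\sigma$ is the left shift $\sigma(x_0,x_1,\dots)=(x_1,x_2,\dots)$. *)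

theory Defs
  imports "HOL-Analysis.Analysis" "Berlekamp_Zassenhaus.Finite_Field"
begin

section \<open>The $p$-adic absolute value on the rationals\<close>

definition padic_abs :: "nat \<Rightarrow> rat \<Rightarrow> real" where
  "padic_abs p x = (if x = 0 then 0
     else real p powi (int (multiplicity (int p) (snd (quotient_of x)))
                       - int (multiplicity (int p) (fst (quotient_of x)))))"

context
  fixes p :: nat
  assumes p: "prime p"
begin

lemma padic_abs_0 [simp]: "padic_abs p 0 = 0"
  by (simp add: padic_abs_def)

lemma padic_abs_1 [simp]: "padic_abs p 1 = 1"
  by (simp add: padic_abs_def)

lemma padic_abs_frac:
  assumes "a \<noteq> 0" "b \<noteq> 0"
  shows "padic_abs p (of_int a / of_int b) =
    real p powi (int (multiplicity (int p) b) - int (multiplicity (int p) a))"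
proof -
  define x :: rat where "x = of_int a / of_int b"
  obtain c d where cd: "quotient_of x = (c, d)" by force
  have d: "d > 0" using quotient_of_denom_pos[OF cd] .
  have x: "x = of_int c / of_int d" using quotient_of_div[OF cd] .
  have x0: "x \<noteq> 0" using assms by (simp add: x_def)
  have c: "c \<noteq> 0" using x x0 by auto
  have "(of_int (a * d) :: rat) = of_int (c * b)"
    using x x_def assms d by (simp add: field_simps)
  hence "a * d = c * b" by (simp only: of_int_eq_iff)
  hence "multiplicity (int p) (a * d) = multiplicity (int p) (c * b)" by simp
  moreover have "prime_elem (int p)" using p by auto
  ultimately have "multiplicity (int p) a + multiplicity (int p) d =
      multiplicity (int p) c + multiplicity (int p) b"
    using assms c d by (simp add: prime_elem_multiplicity_mult_distrib)
  hence "int (multiplicity (int p) d) - int (multiplicity (int p) c) =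
         int (multiplicity (int p) b) - int (multiplicity (int p) a)" by linarith
  thus ?thesis using x0 unfolding padic_abs_def x_def[symmetric] by (simp add: cd)
qed

lemma padic_abs_nonneg [simp]: "0 \<le> padic_abs p x"
  by (simp add: padic_abs_def)

lemma padic_abs_eq_0_iff [simp]: "padic_abs p x = 0 \<longleftrightarrow> x = 0"
  using p by (auto simp: padic_abs_def prime_gt_0_nat)

lemma rat_frac_exhaust:
  obtains a b :: int where "x = of_int a / (of_int b :: rat)" "b \<noteq> 0"
proof -
  obtain c d where cd: "quotient_of x = (c, d)" by force
  show ?thesis using that[of c d] quotient_of_div[OF cd] quotient_of_denom_pos[OF cd] by auto
qed

lemma padic_abs_mult: "padic_abs p (x * y) = padic_abs p x * padic_abs p y"
proof (cases "x = 0 \<or> y = 0")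
  case False
  obtain a b where x: "x = of_int a / of_int b" and b: "b \<noteq> 0" by (rule rat_frac_exhaust)
  obtain c d where y: "y = of_int c / of_int d" and d: "d \<noteq> 0" by (rule rat_frac_exhaust)
  have a: "a \<noteq> 0" and c: "c \<noteq> 0" using False x y by auto
  have pe: "prime_elem (int p)" using p by auto
  have "x * y = of_int (a * c) / of_int (b * d)" by (simp add: x y)
  hence "padic_abs p (x * y) =
    real p powi (int (multiplicity (int p) (b * d)) - int (multiplicity (int p) (a * c)))"
    using padic_abs_frac[of "a * c" "b * d"] a b c d by simp
  also have "\<dots> = real p powi ((int (multiplicity (int p) b) - int (multiplicity (int p) a))
      + (int (multiplicity (int p) d) - int (multiplicity (int p) c)))"
    using a b c d pe by (simp add: prime_elem_multiplicity_mult_distrib algebra_simps)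
  also have "\<dots> = padic_abs p x * padic_abs p y"
    using padic_abs_frac[OF a b] padic_abs_frac[OF c d] p
    by (simp add: x y power_int_add prime_gt_0_nat)
  finally show ?thesis .
qed auto

lemma padic_abs_minus [simp]: "padic_abs p (- x) = padic_abs p x"
proof -
  have "padic_abs p (-1) ^ 2 = 1"
    using padic_abs_mult[of "-1" "-1"] by (simp add: power2_eq_square)
  hence "padic_abs p (-1) = 1"
    using padic_abs_nonneg[of "-1"] by (simp add: power2_eq_1_iff)
  thus ?thesis using padic_abs_mult[of "-1" x] by simp
qed

lemma padic_abs_minus_commute: "padic_abs p (x - y) = padic_abs p (y - x)"
  using padic_abs_minus[of "x - y"] by simp

lemma padic_abs_inverse: "padic_abs p (inverse x) = inverse (padic_abs p x)"
proof (cases "x = 0")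
  case False
  hence "padic_abs p (inverse x) * padic_abs p x = 1"
    using padic_abs_mult[of "inverse x" x] by simp
  thus ?thesis using False by (simp add: field_simps)
qed auto

lemma padic_abs_add_max: "padic_abs p (x + y) \<le> max (padic_abs p x) (padic_abs p y)"
proof (cases "x = 0 \<or> y = 0 \<or> x + y = 0")
  case True
  thus ?thesis by (auto simp: le_max_iff_disj)
next
  case False
  obtain a b where x: "x = of_int a / of_int b" and b: "b \<noteq> 0" by (rule rat_frac_exhaust)
  obtain c d where y: "y = of_int c / of_int d" and d: "d \<noteq> 0" by (rule rat_frac_exhaust)
  define A C M where "A = a * d" and "C = c * b" and "M = b * d"
  have M: "M \<noteq> 0" using b d by (simp add: M_def)
  have x': "x = of_int A / of_int M" and y': "y = of_int C / of_int M"
    using b d by (simp_all add: x y A_def C_def M_def)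
  have xy: "x + y = of_int (A + C) / of_int M" by (simp add: x' y' add_divide_distrib)
  have A: "A \<noteq> 0" and C: "C \<noteq> 0" and AC: "A + C \<noteq> 0"
    using False x' y' xy by (fastforce simp del: of_int_add)+
  have np: "\<not> is_unit (int p)" using p by (auto dest: prime_gt_1_nat)
  let ?m = "multiplicity (int p)"
  have "int p ^ min (?m A) (?m C) dvd A + C"
    by (intro dvd_add multiplicity_dvd') auto
  hence le: "min (?m A) (?m C) \<le> ?m (A + C)"
    using AC np by (intro multiplicity_geI) auto
  have p1: "1 \<le> real p" using prime_ge_1_nat[OF p] by simp
  have "real p powi (int (?m M) - int (?m (A + C))) \<le>
    max (real p powi (int (?m M) - int (?m A))) (real p powi (int (?m M) - int (?m C)))"
  proof (cases "?m A \<le> ?m C")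
    case True
    hence "real p powi (int (?m M) - int (?m (A + C))) \<le> real p powi (int (?m M) - int (?m A))"
      using le p1 by (intro power_int_increasing) auto
    thus ?thesis by simp
  next
    case False
    hence "real p powi (int (?m M) - int (?m (A + C))) \<le> real p powi (int (?m M) - int (?m C))"
      using le p1 by (intro power_int_increasing) auto
    thus ?thesis by simp
  qed
  thus ?thesis
    unfolding x' y' xy[unfolded x' y'] padic_abs_frac[OF A M] padic_abs_frac[OF C M]
      padic_abs_frac[OF AC M] .
qed

lemma padic_abs_triangle: "padic_abs p (x + y) \<le> padic_abs p x + padic_abs p y"
  using padic_abs_add_max[of x y] padic_abs_nonneg[of x] padic_abs_nonneg[of y] by linarith

lemma padic_abs_triangle_diff: "padic_abs p (x - y) \<le> padic_abs p x + padic_abs p y"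
  using padic_abs_triangle[of x "- y"] by simp

lemma padic_abs_diff_abs: "\<bar>padic_abs p x - padic_abs p y\<bar> \<le> padic_abs p (x - y)"
  using padic_abs_triangle[of "x - y" y] padic_abs_triangle[of "y - x" x]
    padic_abs_minus_commute[of x y] by simp

end


section \<open>Cauchy sequences of rationals with respect to the $p$-adic absolute value\<close>

definition padic_cauchy :: "nat \<Rightarrow> (nat \<Rightarrow> rat) \<Rightarrow> bool" where
  "padic_cauchy p X \<longleftrightarrow> (\<forall>e>0. \<exists>N. \<forall>m\<ge>N. \<forall>n\<ge>N. padic_abs p (X m - X n) < e)"

definition padic_null :: "nat \<Rightarrow> (nat \<Rightarrow> rat) \<Rightarrow> bool" where
  "padic_null p X \<longleftrightarrow> (\<lambda>n. padic_abs p (X n)) \<longlonglongrightarrow> 0"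

context
  fixes p :: nat
  assumes p: "prime p"
begin

lemma padic_cauchy_const: "padic_cauchy p (\<lambda>_. c)"
  by (simp add: padic_cauchy_def p)

lemma padic_null_0: "padic_null p (\<lambda>_. 0)"
  by (simp add: padic_null_def p)

lemma padic_nullI:
  assumes "g \<longlonglongrightarrow> 0" "eventually (\<lambda>n. padic_abs p (X n) \<le> g n) sequentially"
  shows "padic_null p X"
  unfolding padic_null_def
  by (rule tendsto_sandwich[OF _ assms(2) tendsto_const assms(1)]) (simp add: p)

lemma padic_null_add: "padic_null p X \<Longrightarrow> padic_null p Y \<Longrightarrow> padic_null p (\<lambda>n. X n + Y n)"
  by (rule padic_nullI[where g = "\<lambda>n. padic_abs p (X n) + padic_abs p (Y n)"])
     (auto simp: padic_null_def p padic_abs_triangle intro!: tendsto_add_zero)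

lemma padic_null_minus: "padic_null p (\<lambda>n. - X n) \<longleftrightarrow> padic_null p X"
  by (simp add: padic_null_def p)

lemma padic_null_diff: "padic_null p X \<Longrightarrow> padic_null p Y \<Longrightarrow> padic_null p (\<lambda>n. X n - Y n)"
  using padic_null_add[of X "\<lambda>n. - Y n"] by (simp add: padic_null_minus)

lemma padic_null_commute: "padic_null p (\<lambda>n. X n - Y n) \<longleftrightarrow> padic_null p (\<lambda>n. Y n - X n)"
  by (simp add: padic_null_def padic_abs_minus_commute[OF p])

lemma padic_cauchy_convergent:
  assumes "padic_cauchy p X"
  shows "convergent (\<lambda>n. padic_abs p (X n))"
proof -
  have "Cauchy (\<lambda>n. padic_abs p (X n))"
  proof (rule metric_CauchyI)
    fix e :: real assume "e > 0"
    then obtain N where N: "\<And>m n. m \<ge> N \<Longrightarrow> n \<ge> N \<Longrightarrow> padic_abs p (X m - X n) < e"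
      using assms unfolding padic_cauchy_def by blast
    show "\<exists>M. \<forall>m\<ge>M. \<forall>n\<ge>M. dist (padic_abs p (X m)) (padic_abs p (X n)) < e"
      unfolding dist_real_def
      by (intro exI[of _ N] allI impI le_less_trans[OF padic_abs_diff_abs[OF p] N])
  qed
  thus ?thesis by (simp add: Cauchy_convergent_iff)
qed

lemma padic_cauchy_bound:
  assumes "padic_cauchy p X"
  obtains B where "B > 0" "\<And>n. padic_abs p (X n) \<le> B"
proof -
  have "Bseq (\<lambda>n. padic_abs p (X n))"
    using padic_cauchy_convergent[OF assms] by (rule convergent_imp_Bseq)
  then obtain B where "B > 0" "\<And>n. norm (padic_abs p (X n)) \<le> B"
    unfolding Bseq_def by blast
  thus ?thesis using that[of B] by (simp add: p)
qed

lemma padic_cauchy_minus: "padic_cauchy p X \<Longrightarrow> padic_cauchy p (\<lambda>n. - X n)"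
  unfolding padic_cauchy_def minus_diff_minus padic_abs_minus[OF p] .

lemma padic_cauchy_add:
  assumes "padic_cauchy p X" "padic_cauchy p Y"
  shows "padic_cauchy p (\<lambda>n. X n + Y n)"
  unfolding padic_cauchy_def
proof (intro allI impI)
  fix e :: real assume "e > 0"
  hence e2: "e / 2 > 0" by simp
  obtain N where N: "\<And>m n. m \<ge> N \<Longrightarrow> n \<ge> N \<Longrightarrow> padic_abs p (X m - X n) < e / 2"
    using assms(1) e2 unfolding padic_cauchy_def by blast
  obtain M where M: "\<And>m n. m \<ge> M \<Longrightarrow> n \<ge> M \<Longrightarrow> padic_abs p (Y m - Y n) < e / 2"
    using assms(2) e2 unfolding padic_cauchy_def by blast
  show "\<exists>N. \<forall>m\<ge>N. \<forall>n\<ge>N. padic_abs p (X m + Y m - (X n + Y n)) < e"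
  proof (intro exI[of _ "max N M"] allI impI)
    fix m n assume "m \<ge> max N M" "n \<ge> max N M"
    thus "padic_abs p (X m + Y m - (X n + Y n)) < e"
      using N[of m n] M[of m n] padic_abs_triangle[OF p, of "X m - X n" "Y m - Y n"]
      by (simp add: add_diff_add)
  qed
qed

lemma padic_null_mult_bounded:
  assumes "padic_cauchy p X" "padic_null p Y"
  shows "padic_null p (\<lambda>n. X n * Y n)"
proof -
  obtain B where B: "B > 0" "\<And>n. padic_abs p (X n) \<le> B"
    using padic_cauchy_bound[OF assms(1)] by blast
  show ?thesis
  proof (rule padic_nullI[where g = "\<lambda>n. B * padic_abs p (Y n)"])
    show "(\<lambda>n. B * padic_abs p (Y n)) \<longlonglongrightarrow> 0"
      using assms(2) unfolding padic_null_def by (rule tendsto_mult_right_zero)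
    show "\<forall>\<^sub>F n in sequentially. padic_abs p (X n * Y n) \<le> B * padic_abs p (Y n)"
      using B by (simp add: padic_abs_mult[OF p] p mult_right_mono)
  qed
qed

lemma padic_cauchy_mult:
  assumes "padic_cauchy p X" "padic_cauchy p Y"
  shows "padic_cauchy p (\<lambda>n. X n * Y n)"
  unfolding padic_cauchy_def
proof (intro allI impI)
  fix e :: real assume e: "e > 0"
  obtain B where B: "B > 0" "\<And>n. padic_abs p (X n) \<le> B"
    using padic_cauchy_bound[OF assms(1)] by blast
  obtain C where C: "C > 0" "\<And>n. padic_abs p (Y n) \<le> C"
    using padic_cauchy_bound[OF assms(2)] by blast
  have "e / (2 * C) > 0" "e / (2 * B) > 0" using e B C by auto
  note pos = this
  obtain N where N: "\<And>m n. m \<ge> N \<Longrightarrow> n \<ge> N \<Longrightarrow> padic_abs p (X m - X n) < e / (2 * C)"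
    using assms(1) pos(1) unfolding padic_cauchy_def by blast
  obtain M where M: "\<And>m n. m \<ge> M \<Longrightarrow> n \<ge> M \<Longrightarrow> padic_abs p (Y m - Y n) < e / (2 * B)"
    using assms(2) pos(2) unfolding padic_cauchy_def by blast
  show "\<exists>N. \<forall>m\<ge>N. \<forall>n\<ge>N. padic_abs p (X m * Y m - X n * Y n) < e"
  proof (intro exI[of _ "max N M"] allI impI)
    fix m n assume mn: "m \<ge> max N M" "n \<ge> max N M"
    have "X m * Y m - X n * Y n = X m * (Y m - Y n) + (X m - X n) * Y n"
      by (simp add: algebra_simps)
    hence "padic_abs p (X m * Y m - X n * Y n) \<le>
        padic_abs p (X m) * padic_abs p (Y m - Y n) + padic_abs p (X m - X n) * padic_abs p (Y n)"
      using padic_abs_triangle[OF p, of "X m * (Y m - Y n)" "(X m - X n) * Y n"]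
      by (simp only: padic_abs_mult[OF p])
    also have "\<dots> \<le> B * padic_abs p (Y m - Y n) + padic_abs p (X m - X n) * C"
      using B C by (intro add_mono mult_right_mono mult_left_mono) (auto simp: p)
    also have "\<dots> < B * (e / (2 * B)) + e / (2 * C) * C"
      using B C M[of m n] N[of m n] mn by (intro add_strict_mono mult_strict_left_mono mult_strict_right_mono) auto
    also have "\<dots> = e" using B C by simp
    finally show "padic_abs p (X m * Y m - X n * Y n) < e" .
  qed
qed

lemma padic_cauchy_not_null:
  assumes "padic_cauchy p X" "\<not> padic_null p X"
  obtains c N where "c > 0" "\<And>n. n \<ge> N \<Longrightarrow> c < padic_abs p (X n)"
proof -
  obtain L where L: "(\<lambda>n. padic_abs p (X n)) \<longlonglongrightarrow> L"
    using padic_cauchy_convergent[OF assms(1)] by (auto simp: convergent_def)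
  have "L \<ge> 0" by (rule LIMSEQ_le_const[OF L]) (simp add: p)
  moreover have "L \<noteq> 0" using L assms(2) by (auto simp: padic_null_def)
  ultimately have "L / 2 > 0" "L / 2 < L" by auto
  moreover have "\<forall>\<^sub>F n in sequentially. L / 2 < padic_abs p (X n)"
    using order_tendstoD(1)[OF L \<open>L / 2 < L\<close>] .
  ultimately show ?thesis using that unfolding eventually_sequentially by blast
qed

lemma padic_abs_diff_inverse:
  assumes "x \<noteq> 0" "y \<noteq> 0"
  shows "padic_abs p (inverse x - inverse y) =
    padic_abs p (x - y) * (inverse (padic_abs p x) * inverse (padic_abs p y))"
proof -
  have "inverse x - inverse y = - ((x - y) * (inverse x * inverse y))"
    using assms by (simp add: field_simps)
  thus ?thesis by (simp add: padic_abs_mult[OF p] padic_abs_inverse[OF p] p)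
qed

lemma padic_abs_diff_inverse_le:
  assumes "c > 0" "c < padic_abs p x" "d > 0" "d < padic_abs p y"
  shows "padic_abs p (inverse x - inverse y) \<le> padic_abs p (x - y) * (inverse c * inverse d)"
proof -
  have "x \<noteq> 0" "y \<noteq> 0" using assms p by auto
  moreover have "inverse (padic_abs p x) * inverse (padic_abs p y) \<le> inverse c * inverse d"
    using assms by (intro mult_mono le_imp_inverse_le) (simp_all add: p)
  ultimately show ?thesis
    by (simp add: padic_abs_diff_inverse mult_left_mono p)
qed

lemma padic_cauchy_inverse:
  assumes "padic_cauchy p X" "\<not> padic_null p X"
  shows "padic_cauchy p (\<lambda>n. inverse (X n))"
  unfolding padic_cauchy_def
proof (intro allI impI)
  fix e :: real assume e: "e > 0"
  obtain c N where c: "c > 0" and N: "\<And>n. n \<ge> N \<Longrightarrow> c < padic_abs p (X n)"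
    using padic_cauchy_not_null[OF assms] by blast
  have "e * (c * c) > 0" using e c by simp
  then obtain M where M: "\<And>m n. m \<ge> M \<Longrightarrow> n \<ge> M \<Longrightarrow> padic_abs p (X m - X n) < e * (c * c)"
    using assms(1) unfolding padic_cauchy_def by blast
  show "\<exists>N. \<forall>m\<ge>N. \<forall>n\<ge>N. padic_abs p (inverse (X m) - inverse (X n)) < e"
  proof (intro exI[of _ "max N M"] allI impI)
    fix m n assume mn: "m \<ge> max N M" "n \<ge> max N M"
    have "padic_abs p (inverse (X m) - inverse (X n)) \<le>
        padic_abs p (X m - X n) * (inverse c * inverse c)"
      using padic_abs_diff_inverse_le[OF c N c N] mn by simp
    also have "\<dots> < e * (c * c) * (inverse c * inverse c)"
      using M[of m n] mn c by (intro mult_strict_right_mono) auto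
    also have "\<dots> = e" using c by (simp add: field_simps)
    finally show "padic_abs p (inverse (X m) - inverse (X n)) < e" .
  qed
qed

lemma padic_null_diff_inverse:
  assumes "padic_cauchy p X" "\<not> padic_null p X" "padic_cauchy p Y" "\<not> padic_null p Y"
    and "padic_null p (\<lambda>n. X n - Y n)"
  shows "padic_null p (\<lambda>n. inverse (X n) - inverse (Y n))"
proof -
  obtain c N where c: "c > 0" and N: "\<And>n. n \<ge> N \<Longrightarrow> c < padic_abs p (X n)"
    using padic_cauchy_not_null[OF assms(1,2)] by blast
  obtain d M where d: "d > 0" and M: "\<And>n. n \<ge> M \<Longrightarrow> d < padic_abs p (Y n)"
    using padic_cauchy_not_null[OF assms(3,4)] by blast
  show ?thesis
  proof (rule padic_nullI)
    show "(\<lambda>n. padic_abs p (X n - Y n) * (inverse c * inverse d)) \<longlonglongrightarrow> 0"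
      using assms(5) unfolding padic_null_def by (rule tendsto_mult_left_zero)
    show "\<forall>\<^sub>F n in sequentially. padic_abs p (inverse (X n) - inverse (Y n)) \<le>
        padic_abs p (X n - Y n) * (inverse c * inverse d)"
      using eventually_ge_at_top[of "max N M"]
    proof eventually_elim
      case (elim n)
      thus ?case using padic_abs_diff_inverse_le[OF c N[of n] d M[of n]] by simp
    qed
  qed
qed

lemma padic_null_inverse_mult:
  assumes "padic_cauchy p X" "\<not> padic_null p X"
  shows "padic_null p (\<lambda>n. inverse (X n) * X n - 1)"
proof -
  obtain c N where c: "c > 0" and N: "\<And>n. n \<ge> N \<Longrightarrow> c < padic_abs p (X n)"
    using padic_cauchy_not_null[OF assms] by blast
  have "X n \<noteq> 0" if "n \<ge> N" for n
    using N[OF that] c by (auto simp: p)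
  hence "\<forall>\<^sub>F n in sequentially. padic_abs p (inverse (X n) * X n - 1) \<le> 0"
    unfolding eventually_sequentially by (intro exI[of _ N]) (simp add: p)
  thus ?thesis by (rule padic_nullI[OF tendsto_const])
qed

end


section \<open>The field of $p$-adic numbers\<close>

text \<open>
  The prime \<open>p\<close> is carried by a type parameter \<open>'p\<close> of class \<^class>\<open>prime_card\<close>, with
  \<open>p = CARD('p)\<close>.  The field \<open>'p padic\<close> is the completion of the rationals at \<open>p\<close>: the ring
  \<open>'p padic_seq\<close> of Cauchy sequences modulo the ideal of null sequences.
\<close>

typedef (overloaded) 'p padic_seq = "{X. padic_cauchy CARD('p::prime_card) X}"
  using padic_cauchy_const[OF prime_card] by blast

setup_lifting type_definition_padic_seq

instantiation padic_seq :: (prime_card) comm_ring_1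
begin

lift_definition zero_padic_seq :: "'a padic_seq" is "\<lambda>_. 0"
  by (rule padic_cauchy_const[OF prime_card])

lift_definition one_padic_seq :: "'a padic_seq" is "\<lambda>_. 1"
  by (rule padic_cauchy_const[OF prime_card])

lift_definition plus_padic_seq :: "'a padic_seq \<Rightarrow> 'a padic_seq \<Rightarrow> 'a padic_seq"
  is "\<lambda>X Y n. X n + Y n"
  by (rule padic_cauchy_add[OF prime_card])

lift_definition uminus_padic_seq :: "'a padic_seq \<Rightarrow> 'a padic_seq" is "\<lambda>X n. - X n"
  by (rule padic_cauchy_minus[OF prime_card])

lift_definition minus_padic_seq :: "'a padic_seq \<Rightarrow> 'a padic_seq \<Rightarrow> 'a padic_seq"
  is "\<lambda>X Y n. X n - Y n"
  using padic_cauchy_add[OF prime_card] padic_cauchy_minus[OF prime_card] by fastforce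

lift_definition times_padic_seq :: "'a padic_seq \<Rightarrow> 'a padic_seq \<Rightarrow> 'a padic_seq"
  is "\<lambda>X Y n. X n * Y n"
  by (rule padic_cauchy_mult[OF prime_card])

instance
proof
  show "(0::'a padic_seq) \<noteq> 1"
    by transfer (simp add: fun_eq_iff)
qed (transfer; simp add: algebra_simps)+

end

lift_definition padic_seq_null :: "'p::prime_card padic_seq \<Rightarrow> bool" is "padic_null CARD('p)" .

lift_definition padic_seq_inverse :: "'p::prime_card padic_seq \<Rightarrow> 'p padic_seq"
  is "\<lambda>X. if padic_null CARD('p) X then (\<lambda>_. 0) else (\<lambda>n. inverse (X n))"
  by (auto simp: padic_cauchy_const padic_cauchy_inverse prime_card)

lift_definition padic_seq_norm :: "'p::prime_card padic_seq \<Rightarrow> real"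
  is "\<lambda>X. lim (\<lambda>n. padic_abs CARD('p) (X n))" .

lemma padic_seq_null_0 [simp]: "padic_seq_null 0"
  by transfer (rule padic_null_0[OF prime_card])

lemma padic_seq_null_1 [simp]: "\<not> padic_seq_null 1"
  by transfer (simp add: padic_null_def prime_card LIMSEQ_const_iff)

lemma padic_seq_null_add: "padic_seq_null X \<Longrightarrow> padic_seq_null Y \<Longrightarrow> padic_seq_null (X + Y)"
  by transfer (rule padic_null_add[OF prime_card])

lemma padic_seq_null_diff: "padic_seq_null X \<Longrightarrow> padic_seq_null Y \<Longrightarrow> padic_seq_null (X - Y)"
  by transfer (rule padic_null_diff[OF prime_card])

lemma padic_seq_null_commute: "padic_seq_null (X - Y) \<longleftrightarrow> padic_seq_null (Y - X)"
  by transfer (rule padic_null_commute[OF prime_card])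

lemma padic_seq_null_mult: "padic_seq_null Y \<Longrightarrow> padic_seq_null (X * Y)"
  by transfer (rule padic_null_mult_bounded[OF prime_card])

lemma padic_seq_null_cong:
  assumes "padic_seq_null (X - Y)"
  shows "padic_seq_null X \<longleftrightarrow> padic_seq_null Y"
  using padic_seq_null_add[OF assms, of Y] padic_seq_null_diff[OF _ assms, of X] by auto

lemma padic_seq_inverse_null: "padic_seq_null X \<Longrightarrow> padic_seq_inverse X = 0"
  by transfer simp

lemma padic_seq_inverse_cong:
  assumes "padic_seq_null (X - Y)"
  shows "padic_seq_null (padic_seq_inverse X - padic_seq_inverse Y)"
proof (cases "padic_seq_null X")
  case True
  thus ?thesis using padic_seq_null_cong[OF assms] by (simp add: padic_seq_inverse_null)
next
  case False
  moreover from this have "\<not> padic_seq_null Y" using padic_seq_null_cong[OF assms] by simp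
  ultimately show ?thesis using assms
    by transfer (simp add: padic_null_diff_inverse prime_card)
qed

lemma padic_seq_inverse_mult:
  "\<not> padic_seq_null X \<Longrightarrow> padic_seq_null (padic_seq_inverse X * X - 1)"
  by transfer (simp add: padic_null_inverse_mult prime_card)

lemma padic_seq_norm_lim:
  "(\<lambda>n. padic_abs CARD('p) (Rep_padic_seq X n)) \<longlonglongrightarrow> padic_seq_norm (X :: 'p::prime_card padic_seq)"
  using padic_cauchy_convergent[OF prime_card, of "Rep_padic_seq X"] Rep_padic_seq[of X]
  by (simp add: padic_seq_norm.rep_eq convergent_LIMSEQ_iff)

lemma padic_seq_norm_eq_0_iff: "padic_seq_norm X = 0 \<longleftrightarrow> padic_seq_null X"
  using padic_seq_norm_lim[of X]
  by (auto simp: padic_seq_null.rep_eq padic_null_def dest: LIMSEQ_unique)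

lemma padic_seq_norm_triangle: "padic_seq_norm (X + Y) \<le> padic_seq_norm X + padic_seq_norm Y"
  by (rule LIMSEQ_le[OF padic_seq_norm_lim
        tendsto_add[OF padic_seq_norm_lim padic_seq_norm_lim]])
     (simp add: plus_padic_seq.rep_eq padic_abs_triangle prime_card)

lemma padic_seq_norm_minus: "padic_seq_norm (- X) = padic_seq_norm X"
  by transfer (simp add: prime_card)

lemma padic_seq_norm_cong:
  assumes "padic_seq_null (X - Y)"
  shows "padic_seq_norm X = padic_seq_norm Y"
proof -
  have "padic_seq_norm (X - Y) = 0" "padic_seq_norm (Y - X) = 0"
    using assms by (simp_all add: padic_seq_norm_eq_0_iff padic_seq_null_commute)
  thus ?thesis
    using padic_seq_norm_triangle[of "X - Y" Y] padic_seq_norm_triangle[of "Y - X" X] by simp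
qed

definition padic_rel :: "'p::prime_card padic_seq \<Rightarrow> 'p padic_seq \<Rightarrow> bool" where
  "padic_rel X Y \<longleftrightarrow> padic_seq_null (X - Y)"

lemma padic_rel_refl [simp]: "padic_rel X X"
  by (simp add: padic_rel_def)

lemma equivp_padic_rel: "equivp (padic_rel :: 'p::prime_card padic_seq \<Rightarrow> _)"
proof (rule equivpI)
  show "reflp (padic_rel :: 'p padic_seq \<Rightarrow> _)" by (simp add: reflp_def)
  show "symp (padic_rel :: 'p padic_seq \<Rightarrow> _)" by (simp add: symp_def padic_rel_def padic_seq_null_commute)
  show "transp (padic_rel :: 'p padic_seq \<Rightarrow> _)"
  proof (rule transpI)
    fix X Y Z :: "'p padic_seq" assume "padic_rel X Y" "padic_rel Y Z"
    thus "padic_rel X Z"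
      using padic_seq_null_add[of "X - Y" "Y - Z"] by (simp add: padic_rel_def)
  qed
qed

quotient_type (overloaded) 'p padic = "'p::prime_card padic_seq" / padic_rel
  by (rule equivp_padic_rel)

instantiation padic :: (prime_card) field
begin

lift_definition zero_padic :: "'a padic" is 0 .

lift_definition one_padic :: "'a padic" is 1 .

lift_definition plus_padic :: "'a padic \<Rightarrow> 'a padic \<Rightarrow> 'a padic" is "(+)"
  by (simp add: padic_rel_def add_diff_add padic_seq_null_add)

lift_definition uminus_padic :: "'a padic \<Rightarrow> 'a padic" is uminus
  by (simp add: padic_rel_def padic_seq_null_commute)

lift_definition minus_padic :: "'a padic \<Rightarrow> 'a padic \<Rightarrow> 'a padic" is "(-)"
proof -
  fix X X' Y Y' :: "'a padic_seq"
  assume "padic_rel X X'" "padic_rel Y Y'"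
  hence "padic_seq_null ((X - X') - (Y - Y'))"
    by (simp add: padic_rel_def padic_seq_null_diff)
  thus "padic_rel (X - Y) (X' - Y')"
    by (simp add: padic_rel_def algebra_simps)
qed

lift_definition times_padic :: "'a padic \<Rightarrow> 'a padic \<Rightarrow> 'a padic" is "(*)"
proof -
  fix X X' Y Y' :: "'a padic_seq"
  assume "padic_rel X X'" "padic_rel Y Y'"
  hence "padic_seq_null (X * (Y - Y') + Y' * (X - X'))"
    by (simp add: padic_rel_def padic_seq_null_add padic_seq_null_mult)
  thus "padic_rel (X * Y) (X' * Y')"
    by (simp add: padic_rel_def algebra_simps)
qed

lift_definition inverse_padic :: "'a padic \<Rightarrow> 'a padic" is padic_seq_inverse
  by (simp add: padic_rel_def padic_seq_inverse_cong)

definition "x div y = x * inverse y" for x y :: "'a padic"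

instance
proof
  fix a b c :: "'a padic"
  show "a + b = b + a"
    by transfer (simp add: add.commute)
  show "a + b + c = a + (b + c)"
    by transfer (simp add: add.assoc)
  show "0 + a = a"
    by transfer simp
  show "- a + a = 0"
    by transfer simp
  show "a - b = a + - b"
    by transfer simp
  show "a * b * c = a * (b * c)"
    by transfer (simp add: mult.assoc)
  show "a * b = b * a"
    by transfer (simp add: mult.commute)
  show "1 * a = a"
    by transfer simp
  show "(a + b) * c = a * c + b * c"
    by transfer (simp add: distrib_right)
  show "(0::'a padic) \<noteq> 1"
    using padic_seq_null_commute[of "0::'a padic_seq" 1]
    by transfer (simp add: padic_rel_def)
  show "a \<noteq> 0 \<Longrightarrow> inverse a * a = 1"
    by transfer (simp add: padic_rel_def padic_seq_inverse_mult)
  show "a div b = a * inverse b"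
    by (rule divide_padic_def)
  show "inverse (0::'a padic) = 0"
    by transfer (simp add: padic_seq_inverse_null)
qed

end

lift_definition padic_norm :: "'p::prime_card padic \<Rightarrow> real" is padic_seq_norm
  by (simp add: padic_rel_def padic_seq_norm_cong)

lemma padic_norm_eq_0_iff: "padic_norm x = 0 \<longleftrightarrow> x = 0"
  by transfer (simp add: padic_rel_def padic_seq_norm_eq_0_iff)

lemma padic_norm_triangle: "padic_norm (x + y) \<le> padic_norm x + padic_norm y"
  by transfer (rule padic_seq_norm_triangle)

lemma padic_norm_minus: "padic_norm (- x) = padic_norm x"
  by transfer (rule padic_seq_norm_minus)

instantiation padic :: (prime_card) metric_space
begin

definition dist_padic :: "'a padic \<Rightarrow> 'a padic \<Rightarrow> real" where
  "dist_padic x y = padic_norm (x - y)"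

definition uniformity_padic :: "('a padic \<times> 'a padic) filter" where
  "uniformity_padic = (INF e\<in>{0 <..}. principal {(x, y). dist x y < e})"

definition open_padic :: "'a padic set \<Rightarrow> bool" where
  "open_padic U \<longleftrightarrow> (\<forall>x\<in>U. eventually (\<lambda>(x', y). x' = x \<longrightarrow> y \<in> U) uniformity)"

instance
proof
  fix x y z :: "'a padic"
  show "uniformity = (INF e\<in>{0 <..}. principal {(x :: 'a padic, y). dist x y < e})"
    by (rule uniformity_padic_def)
  show "open U \<longleftrightarrow> (\<forall>x\<in>U. eventually (\<lambda>(x', y). x' = x \<longrightarrow> y \<in> U) uniformity)"
    for U :: "'a padic set"
    by (rule open_padic_def)
  show "dist x y = 0 \<longleftrightarrow> x = y"
    by (simp add: dist_padic_def padic_norm_eq_0_iff)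
  show "dist x y \<le> dist x z + dist y z"
    using padic_norm_triangle[of "x - z" "z - y"] padic_norm_minus[of "z - y"]
    by (simp add: dist_padic_def)
qed

end


section \<open>The Potts--Bethe mapping\<close>

definition padic_E :: "'p::prime_card padic set" where
  "padic_E = {x. padic_norm (x - 1) \<le> 1 / real CARD('p)}"

text \<open>
  The pole \<open>2 - \<theta> - q\<close>, where HOL's division returns \<open>0\<close>, lies outside the set \<open>potts_X\<close> below
  under the hypotheses of the theorem.
\<close>

definition potts_bethe :: "nat \<Rightarrow> int \<Rightarrow> 'p::prime_card padic \<Rightarrow> 'p padic \<Rightarrow> 'p padic" where
  "potts_bethe k q \<theta> x = ((\<theta> * x + of_int q - 1) / (x + \<theta> + of_int q - 2)) ^ k"

definition Sol :: "nat \<Rightarrow> nat \<Rightarrow> int \<Rightarrow> nat \<Rightarrow> int set" where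
  "Sol p k q s = (if k dvd s
     then {\<xi> \<in> {0..<int p}. [(int p ^ (s div k) * \<xi>) ^ k + q - 1 = 0] (mod int p ^ (s + 1))}
     else {})"

text \<open>\<open>\<eta>\<close> is only used if \<open>s = 0\<close> and \<open>p\<close> does not divide \<open>\<xi> + q - 1\<close>.\<close>

definition potts_center ::
    "int \<Rightarrow> nat \<Rightarrow> nat \<Rightarrow> 'p::prime_card padic \<Rightarrow> int \<Rightarrow> int \<Rightarrow> 'p padic" where
  "potts_center q k s \<theta> \<xi> \<eta> =
     (if s = 0 then
        (if [\<xi> + q - 1 = 0] (mod int CARD('p)) then 1 - of_int q
         else 1 - of_int q + of_int \<eta> * (\<theta> - 1))
      else 1 - of_int q + of_nat CARD('p) ^ (s div k) * of_int \<xi> * (\<theta> - 1))"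

definition potts_radius :: "nat \<Rightarrow> nat \<Rightarrow> 'p::prime_card padic \<Rightarrow> real" where
  "potts_radius k s \<theta> = real CARD('p) powr (- (real (s + k) / real k)) * padic_norm (\<theta> - 1)"

definition potts_X ::
    "int \<Rightarrow> nat \<Rightarrow> nat \<Rightarrow> 'p::prime_card padic \<Rightarrow> nat \<Rightarrow> (nat \<Rightarrow> int) \<Rightarrow> (nat \<Rightarrow> int)
      \<Rightarrow> 'p padic set" where
  "potts_X q k s \<theta> \<kappa> \<xi> \<eta> =
     (\<Union>i\<in>{1..\<kappa>}. cball (potts_center q k s \<theta> (\<xi> i) (\<eta> i)) (potts_radius k s \<theta>))"

text \<open>
  For the partial map \<open>f : X \<rightarrow> \<rat>\<^sub>p\<close>, the preimage \<open>f\<^sup>-\<^sup>n(X)\<close> consists of the points whose first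
  \<open>n\<close> iterates all stay in \<open>X\<close>; intersecting over all \<open>n\<close>, this agrees with taking preimages
  under the iterates of a total extension of \<open>f\<close>.
\<close>

definition julia_set :: "('a \<Rightarrow> 'a) \<Rightarrow> 'a set \<Rightarrow> 'a set" where
  "julia_set f X = (\<Inter>n. (f ^^ n) -` X)"

definition full_shift_space :: "nat \<Rightarrow> (nat \<Rightarrow> nat) topology" where
  "full_shift_space \<kappa> = product_topology (\<lambda>_. discrete_topology {1..\<kappa>}) UNIV"

definition left_shift :: "(nat \<Rightarrow> 'a) \<Rightarrow> (nat \<Rightarrow> 'a)" where
  "left_shift x = (\<lambda>n. x (Suc n))"

end

(*
  In the coordinate x = 1 - q + (theta - 1) t the map is f(x) = g(t)^k with the Moebius map
  g(t) = (theta t + 1 - q) / (t + 1), whose determinant theta - 1 + q is a unit.  Write s = m k.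
  On the t-ball of radius p^(-m-1) belonging to xi_i, g is an isometry onto the ball of the same
  radius around p^m xi_i, and that ball contains a k-th root y_i of 1 - q: correct the given root
  by a root of unity.  On 1 + p Z_p (p odd) the binomial expansion of a^k - b^k is dominated by its
  linear term k (a - b), so the power map expands distances exactly by |k| and, by Banach's fixed
  point theorem, is onto the ball of radius |k| / p.  Hence f expands every ball B_r(x_i) by the
  constant |k| p^(-m (k-1)) / |theta - 1| and maps it onto the ball of radius |k| p^(-s-1) around
  1 - q.  The hypothesis says that the constant exceeds 1; as norms are powers of p, it is then at
  least p, and the image contains X.  Coding points by itineraries conjugates f to the full shift.
*)
theory Submission
  imports Defs "HOL-Number_Theory.Residues"
begin

section \<open>The $p$-adic norm\<close>

lift_definition padic_seq_const :: "rat \<Rightarrow> 'p::prime_card padic_seq" is "\<lambda>r _. r"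
  by (rule padic_cauchy_const[OF prime_card])

lift_definition padic_of_rat :: "rat \<Rightarrow> 'p::prime_card padic" is padic_seq_const .

lemma padic_of_rat_diff: "padic_of_rat (a - b) = padic_of_rat a - padic_of_rat b"
proof (transfer, unfold padic_rel_def)
  fix a b
  have "(padic_seq_const (a - b) :: 'a padic_seq) = padic_seq_const a - padic_seq_const b"
    by transfer simp
  thus "padic_seq_null (padic_seq_const (a - b) - (padic_seq_const a - padic_seq_const b) :: 'a padic_seq)"
    by simp
qed

lemma padic_of_rat_mult: "padic_of_rat (a * b) = padic_of_rat a * padic_of_rat b"
proof (transfer, unfold padic_rel_def)
  fix a b
  have "(padic_seq_const (a * b) :: 'a padic_seq) = padic_seq_const a * padic_seq_const b"
    by transfer simp
  thus "padic_seq_null (padic_seq_const (a * b) - (padic_seq_const a * padic_seq_const b) :: 'a padic_seq)"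
    by simp
qed

lemma padic_of_rat_1 [simp]: "padic_of_rat 1 = 1"
proof (transfer, unfold padic_rel_def)
  have "(padic_seq_const 1 :: 'a padic_seq) = 1"
    by transfer simp
  thus "padic_seq_null (padic_seq_const 1 - 1 :: 'a padic_seq)" by simp
qed

lemma padic_of_rat_0 [simp]: "padic_of_rat 0 = 0"
  using padic_of_rat_diff[of 1 1] by simp

lemma padic_of_rat_minus: "padic_of_rat (- a) = - padic_of_rat a"
  using padic_of_rat_diff[of 0 a] by simp

lemma padic_of_rat_add: "padic_of_rat (a + b) = padic_of_rat a + padic_of_rat b"
  using padic_of_rat_diff[of a "- b"] by (simp add: padic_of_rat_minus)

lemma padic_of_rat_of_nat [simp]: "padic_of_rat (of_nat n) = of_nat n"
  by (induction n) (simp_all add: padic_of_rat_add)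

lemma padic_of_rat_of_int [simp]: "padic_of_rat (of_int n) = of_int n"
  by (cases n) (simp_all add: padic_of_rat_minus padic_of_rat_diff)

lemma padic_norm_of_rat [simp]:
  "padic_norm (padic_of_rat r :: 'p::prime_card padic) = padic_abs CARD('p) r"
  by transfer (simp add: padic_seq_norm.rep_eq padic_seq_const.rep_eq)

lemma padic_norm_mult: "padic_norm (x * y) = padic_norm x * padic_norm y"
proof transfer
  fix X Y :: "'a padic_seq"
  have "(\<lambda>n. padic_abs CARD('a) (Rep_padic_seq (X * Y) n)) \<longlonglongrightarrow> padic_seq_norm X * padic_seq_norm Y"
    using tendsto_mult[OF padic_seq_norm_lim[of X] padic_seq_norm_lim[of Y]]
    by (simp add: times_padic_seq.rep_eq padic_abs_mult prime_card)
  thus "padic_seq_norm (X * Y) = padic_seq_norm X * padic_seq_norm Y"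
    using padic_seq_norm_lim LIMSEQ_unique by blast
qed

lemma padic_norm_add_max: "padic_norm (x + y) \<le> max (padic_norm x) (padic_norm y)"
proof transfer
  fix X Y :: "'a padic_seq"
  show "padic_seq_norm (X + Y) \<le> max (padic_seq_norm X) (padic_seq_norm Y)"
    by (rule LIMSEQ_le[OF padic_seq_norm_lim
        tendsto_max[OF padic_seq_norm_lim padic_seq_norm_lim]])
     (simp add: plus_padic_seq.rep_eq padic_abs_add_max prime_card)
qed

lemma padic_norm_nonneg [simp]: "0 \<le> padic_norm x"
  using zero_le_dist[of x 0] by (simp add: dist_padic_def)

lemma padic_norm_0 [simp]: "padic_norm 0 = 0"
  by (simp add: padic_norm_eq_0_iff)

lemma padic_norm_1 [simp]: "padic_norm 1 = 1"
  by (metis padic_norm_of_rat padic_of_rat_1 padic_abs_1 prime_card)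

lemma padic_norm_pos_iff [simp]: "0 < padic_norm x \<longleftrightarrow> x \<noteq> 0"
  using padic_norm_nonneg[of x] padic_norm_eq_0_iff[of x] by linarith

declare padic_norm_minus [simp] padic_norm_eq_0_iff [simp]

lemma padic_norm_power: "padic_norm (x ^ n) = padic_norm x ^ n"
  by (induction n) (simp_all add: padic_norm_mult)

lemma padic_norm_inverse: "padic_norm (inverse x) = inverse (padic_norm x)"
proof (cases "x = 0")
  case False
  hence "padic_norm (inverse x) * padic_norm x = 1"
    by (simp flip: padic_norm_mult)
  thus ?thesis using False by (simp add: field_simps)
qed auto

lemma padic_norm_divide: "padic_norm (x / y) = padic_norm x / padic_norm y"
  by (simp add: divide_inverse padic_norm_mult padic_norm_inverse)

lemma padic_norm_add_le: "padic_norm x \<le> e \<Longrightarrow> padic_norm y \<le> e \<Longrightarrow> padic_norm (x + y) \<le> e"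
  using padic_norm_add_max[of x y] by simp

lemma padic_norm_diff_le: "padic_norm x \<le> e \<Longrightarrow> padic_norm y \<le> e \<Longrightarrow> padic_norm (x - y) \<le> e"
  using padic_norm_add_le[of x e "- y"] by simp

lemma padic_norm_minus_commute: "padic_norm (x - y) = padic_norm (y - x)"
  using padic_norm_minus[of "x - y"] by simp

lemma padic_norm_trans:
  "padic_norm (x - y) \<le> e \<Longrightarrow> padic_norm (y - z) \<le> e \<Longrightarrow> padic_norm (x - z) \<le> e"
  using padic_norm_add_le[of "x - y" e "y - z"] by simp

lemma padic_norm_sum_le:
  assumes "\<And>i. i \<in> I \<Longrightarrow> padic_norm (g i) \<le> e" "e \<ge> 0"
  shows "padic_norm (\<Sum>i\<in>I. g i) \<le> e"
  using assms(1)
  by (induction I rule: infinite_finite_induct) (auto simp: assms(2) intro!: padic_norm_add_le)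

text \<open>Isosceles triangle principle: the ultrametric inequality bounds |x| by |y|, and applied
  to y = x + (y - x) it bounds |y| by |x|, since |y - x| is too small to attain the maximum.\<close>

lemma padic_norm_dominant:
  assumes "padic_norm (x - y) < padic_norm y"
  shows "padic_norm x = padic_norm y"
proof -
  have "padic_norm x \<le> padic_norm y"
    using padic_norm_add_max[of "x - y" y] assms by simp
  moreover have "padic_norm y \<le> max (padic_norm x) (padic_norm (x - y))"
    using padic_norm_add_max[of x "y - x"] by (simp add: padic_norm_minus_commute)
  ultimately show ?thesis using assms by linarith
qed

section \<open>Norms of integers and divisibility by powers of p\<close>

lemma padic_abs_of_int:
  assumes "prime p" "n \<noteq> 0"
  shows "padic_abs p (of_int n) = 1 / real p ^ multiplicity (int p) n"
  using padic_abs_frac[OF assms(1), of n 1] assms by (simp add: power_int_minus divide_inverse)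

lemma padic_norm_of_int:
  assumes "n \<noteq> 0"
  shows "padic_norm (of_int n :: 'p::prime_card padic) = 1 / real CARD('p) ^ multiplicity (int CARD('p)) n"
  by (metis assms padic_abs_of_int padic_norm_of_rat padic_of_rat_of_int prime_card)

lemma one_less_prime_card: "1 < real CARD('p::prime_card)"
  using prime_gt_1_nat[OF prime_card] by simp

text \<open>The dictionary by which congruences modulo powers of p become norm estimates. Zero is
  treated apart because \<open>multiplicity\<close> carries no information there.\<close>

lemma padic_norm_of_int_le_iff:
  "padic_norm (of_int n :: 'p::prime_card padic) \<le> 1 / real CARD('p) ^ m \<longleftrightarrow> int CARD('p) ^ m dvd n"
proof (cases "n = 0")
  case True thus ?thesis by simp
next
  case False
  have "prime (int CARD('p))" using prime_card by simp
  hence "int CARD('p) ^ m dvd n \<longleftrightarrow> m \<le> multiplicity (int CARD('p)) n"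
    using False by (intro power_dvd_iff_le_multiplicity) (auto dest: prime_gt_1_int)
  also have "\<dots> \<longleftrightarrow> padic_norm (of_int n :: 'p padic) \<le> 1 / real CARD('p) ^ m"
    using one_less_prime_card[where 'p='p]
    by (simp add: padic_norm_of_int[OF False] frac_le_eq divide_le_eq field_simps)
  finally show ?thesis ..
qed

lemma padic_norm_of_int_le_1: "padic_norm (of_int n) \<le> 1"
  using padic_norm_of_int_le_iff[of n 0] by simp

lemma padic_norm_of_nat_le_1: "padic_norm (of_nat n) \<le> 1"
  using padic_norm_of_int_le_1[of "int n"] by simp

lemma padic_norm_of_int_eq_1_iff:
  "padic_norm (of_int n :: 'p::prime_card padic) = 1 \<longleftrightarrow> \<not> int CARD('p) dvd n"
proof (cases "n = 0")
  case False
  have "prime (int CARD('p))" using prime_card by simp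
  hence "multiplicity (int CARD('p)) n = 0 \<longleftrightarrow> \<not> int CARD('p) dvd n"
    using False by (intro multiplicity_eq_zero_iff) (auto dest: prime_gt_1_int)
  thus ?thesis using one_less_prime_card[where 'p='p]
    by (metis div_by_1 divide_eq_1_iff not_gr_zero one_less_power order_less_irrefl padic_norm_of_int[OF False] power_0)
qed auto

lemma padic_norm_prime_card: "padic_norm (of_nat CARD('p) :: 'p::prime_card padic) = 1 / real CARD('p)"
proof -
  have "prime (int CARD('p))" using prime_card by simp
  thus ?thesis using padic_norm_of_int[of "int CARD('p)", where 'p='p] 
    by (simp add: prime_gt_1_int)
qed

section \<open>Density of the rationals and completeness\<close>

lemma padic_rat_approx:
  fixes X :: "'p::prime_card padic_seq"
  assumes "\<And>n. n \<ge> N \<Longrightarrow> padic_abs CARD('p) (Rep_padic_seq X n - Rep_padic_seq X N) \<le> e"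
  shows "padic_norm (abs_padic X - padic_of_rat (Rep_padic_seq X N)) \<le> e"
proof -
  let ?Y = "X - padic_seq_const (Rep_padic_seq X N)"
  have "padic_norm (abs_padic X - padic_of_rat (Rep_padic_seq X N)) = padic_seq_norm ?Y"
    by (simp add: padic_of_rat.abs_eq minus_padic.abs_eq padic_norm.abs_eq)
  also have "\<dots> \<le> e"
    by (rule LIMSEQ_le_const2[OF padic_seq_norm_lim])
       (use assms in \<open>auto simp: minus_padic_seq.rep_eq padic_seq_const.rep_eq\<close>)
  finally show ?thesis .
qed

text \<open>A late term of a representing Cauchy sequence is the approximation. Passing to the limit
  only yields a weak inequality, hence the oscillation is bounded by e/2.\<close>

lemma padic_of_rat_dense:
  fixes x :: "'p::prime_card padic"
  assumes "e > 0"
  obtains r where "padic_norm (x - padic_of_rat r) < e"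
proof -
  obtain X where x: "x = abs_padic X" by (metis Quotient_abs_rep Quotient_padic)
  have "padic_cauchy CARD('p) (Rep_padic_seq X)" using Rep_padic_seq[of X] by simp
  then obtain N where "\<And>n m. n \<ge> N \<Longrightarrow> m \<ge> N \<Longrightarrow>
      padic_abs CARD('p) (Rep_padic_seq X n - Rep_padic_seq X m) < e / 2"
    using assms unfolding padic_cauchy_def by (metis half_gt_zero)
  hence "padic_norm (x - padic_of_rat (Rep_padic_seq X N)) \<le> e / 2"
    unfolding x by (intro padic_rat_approx less_imp_le) auto
  also have "\<dots> < e" using assms by simp
  finally show ?thesis by (rule that)
qed

text \<open>Diagonal argument: rationals \<open>r n\<close> within 1/(n+1) of \<open>u n\<close>
  form a Cauchy sequence of rationals, and the class of that sequence is the limit of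
  \<open>u\<close>.\<close>

instance padic :: (prime_card) complete_space
proof
  fix u :: "nat \<Rightarrow> 'a padic"
  assume u: "Cauchy u"
  have "\<exists>r. \<forall>n. padic_norm (u n - padic_of_rat (r n)) < 1 / Suc n"
    by (rule choice) (metis padic_of_rat_dense of_nat_0_less_iff zero_less_Suc zero_less_divide_1_iff)
  then obtain r where r: "\<And>n. dist (u n) (padic_of_rat (r n)) < 1 / Suc n"
    by (auto simp: dist_padic_def)
  have lim0: "(\<lambda>n. 1 / real (Suc n)) \<longlonglongrightarrow> 0"
    by (rule LIMSEQ_Suc[OF lim_const_over_n[of 1]])
  have abs_dist: "padic_abs CARD('a) (a - b) = dist (padic_of_rat a) (padic_of_rat b :: 'a padic)" for a b
    by (simp add: dist_padic_def flip: padic_of_rat_diff)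
  have cauchy: "padic_cauchy CARD('a) r"
    unfolding padic_cauchy_def
  proof (intro allI impI)
    fix e :: real assume e: "e > 0"
    obtain N where N: "\<And>m n. m \<ge> N \<Longrightarrow> n \<ge> N \<Longrightarrow> dist (u m) (u n) < e / 3"
      using u e unfolding Cauchy_def by (metis zero_less_divide_iff zero_less_numeral)
    obtain M where M: "\<And>n. n \<ge> M \<Longrightarrow> 1 / real (Suc n) < e / 3"
      using order_tendstoD(2)[OF lim0, of "e / 3"] e unfolding eventually_sequentially by auto
    show "\<exists>N. \<forall>m\<ge>N. \<forall>n\<ge>N. padic_abs CARD('a) (r m - r n) < e"
      unfolding abs_dist
    proof (intro exI[of _ "max M N"] allI impI)
      fix m n assume "max M N \<le> m" "max M N \<le> n"
      hence "dist (u m) (u n) < e / 3" "1 / real (Suc n) < e / 3" "1 / real (Suc m) < e / 3"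
        using M N by auto
      thus "dist (padic_of_rat (r m)) (padic_of_rat (r n) :: 'a padic) < e"
        using r[of m] r[of n] by metric
    qed
  qed
  define x :: "'a padic" where "x = abs_padic (Abs_padic_seq r)"
  have Rep: "Rep_padic_seq (Abs_padic_seq r :: 'a padic_seq) = r"
    using cauchy by (simp add: Abs_padic_seq_inverse)
  have "u \<longlonglongrightarrow> x"
  proof (rule metric_LIMSEQ_I)
    fix e :: real assume e: "e > 0"
    obtain N where N: "\<And>m n. m \<ge> N \<Longrightarrow> n \<ge> N \<Longrightarrow> padic_abs CARD('a) (r m - r n) < e / 2"
      using cauchy e unfolding padic_cauchy_def by (metis half_gt_zero)
    obtain M where M: "\<And>n. n \<ge> M \<Longrightarrow> 1 / real (Suc n) < e / 2"
      using order_tendstoD(2)[OF lim0, of "e / 2"] e unfolding eventually_sequentially by auto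
    show "\<exists>no. \<forall>n\<ge>no. dist (u n) x < e"
    proof (intro exI[of _ "max M N"] allI impI)
      fix n assume n: "max M N \<le> n"
      have "dist x (padic_of_rat (r n)) \<le> e / 2"
        unfolding dist_padic_def x_def
        using padic_rat_approx[of n "Abs_padic_seq r :: 'a padic_seq" "e / 2"] N n
        by (simp add: Rep less_imp_le del: le_divide_eq_numeral1 less_divide_eq_numeral1)
      thus "dist (u n) x < e" using r[of n] M[of n] n dist_triangle[of "u n" x "padic_of_rat (r n)"]
        by (simp add: dist_commute)
    qed
  qed
  thus "convergent u" by (rule convergentI)
qed

section \<open>Discreteness of the norm and the residue field\<close>

lemma padic_norm_value:
  fixes x :: "'p::prime_card padic"
  assumes "x \<noteq> 0"
  obtains n :: int where "padic_norm x = real CARD('p) powi n"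
proof -
  obtain r where r: "padic_norm (x - padic_of_rat r) < padic_norm x"
    using padic_of_rat_dense[of "padic_norm x" x] assms by auto
  \<comment> \<open>A rational closer to x than |x| has the same norm, so the completion takes no
    new values.\<close>
  hence "padic_norm x = padic_abs CARD('p) r"
    using padic_norm_dominant[of "padic_of_rat r" x] by (simp add: padic_norm_minus_commute)
  moreover have "r \<noteq> 0" using calculation assms by (auto simp: padic_abs_def)
  ultimately show ?thesis using that by (auto simp: padic_abs_def)
qed

text \<open>Norms are integer powers of p, so a strict inequality gains a full factor p. This later
  turns expansion into covering of the whole of X by the image of one ball.\<close>

lemma padic_norm_less_imp:
  fixes x y :: "'p::prime_card padic"
  assumes "padic_norm x < padic_norm y"
  shows "padic_norm x \<le> padic_norm y / real CARD('p)"
proof (cases "x = 0")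
  case False
  have "y \<noteq> 0" using assms padic_norm_nonneg[of x] by (auto simp flip: not_le)
  obtain a where a: "padic_norm x = real CARD('p) powi a" using False by (rule padic_norm_value)
  obtain b where b: "padic_norm y = real CARD('p) powi b" using \<open>y \<noteq> 0\<close> by (rule padic_norm_value)
  note P = one_less_prime_card[where 'p='p]
  have "a < b" using assms a b P power_int_increasing[of b a "real CARD('p)"] by fastforce
  hence "real CARD('p) powi a \<le> real CARD('p) powi (b - 1)"
    using P by (intro power_int_increasing) auto
  also have "\<dots> = real CARD('p) powi b / real CARD('p)"
    using P by (simp add: power_int_diff)
  finally show ?thesis using a b by simp
qed simp

text \<open>The residue field is that of the integers: x is approximated by a fraction a/b with b
  prime to p, and a times an inverse of b modulo p is the required integer.\<close>

lemma padic_residue: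
  fixes x :: "'p::prime_card padic"
  assumes "padic_norm x \<le> 1"
  obtains n :: int where "padic_norm (x - of_int n) \<le> 1 / real CARD('p)"
proof -
  let ?P = "int CARD('p)"
  note P = one_less_prime_card[where 'p='p]
  obtain r where r: "padic_norm (x - padic_of_rat r) < 1 / real CARD('p)"
    using padic_of_rat_dense[of "1 / real CARD('p)" x] P by auto
  obtain a b where ab: "quotient_of r = (a, b)" by force
  have b: "b > 0" "coprime a b" and req: "r = of_int a / of_int b"
    using quotient_of_denom_pos[OF ab] quotient_of_coprime[OF ab] quotient_of_div[OF ab] by auto
  have "padic_norm (padic_of_rat r :: 'p padic) \<le> 1"
  proof -
    have "1 / real CARD('p) \<le> 1" using P by simp
    hence "padic_norm (padic_of_rat r - x) \<le> 1" using r
      by (simp only: padic_norm_minus_commute[of x])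
    from padic_norm_add_le[OF this assms] show ?thesis by simp
  qed
  have ra: "padic_of_rat r * of_int b = (of_int a :: 'p padic)"
    using padic_of_rat_mult[of r "of_int b", where 'a='p] b req by simp
  \<comment> \<open>The fraction has norm at most 1, so p dividing b would force p to divide a = r b
    as well, against lowest terms.\<close>
  have "\<not> ?P dvd b"
  proof
    assume "?P dvd b"
    hence "padic_norm (of_int b :: 'p padic) \<le> 1 / real CARD('p)"
      using padic_norm_of_int_le_iff[of b 1, where 'p='p] by simp
    hence "padic_norm (of_int a :: 'p padic) \<le> 1 / real CARD('p)"
      unfolding ra[symmetric] padic_norm_mult
      using \<open>padic_norm (padic_of_rat r :: 'p padic) \<le> 1\<close>
      by (meson mult_left_le_one_le order_trans padic_norm_nonneg)
    hence "?P dvd a"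
      using padic_norm_of_int_le_iff[of a 1, where 'p='p] by simp
    with \<open>?P dvd b\<close> b(2) have "is_unit ?P" by (metis coprime_common_divisor)
    thus False using prime_card[where 'a='p] by (auto dest: prime_gt_1_nat)
  qed
  hence nb: "padic_norm (of_int b :: 'p padic) = 1" by (simp add: padic_norm_of_int_eq_1_iff)
  have "coprime b ?P"
    using \<open>\<not> ?P dvd b\<close> prime_card[where 'a='p] prime_imp_coprime[of ?P b]
    by (simp add: coprime_commute)
  then obtain c where c: "[b * c = 1] (mod ?P)" using cong_solve_coprime_int by blast
  have "[b * (c * a) = a] (mod ?P)"
    using cong_scalar_right[OF c, of a] by (simp add: mult.assoc)
  hence "padic_norm (of_int (b * (c * a) - a) :: 'p padic) \<le> 1 / real CARD('p)"
    using padic_norm_of_int_le_iff[of "b * (c * a) - a" 1, where 'p='p]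
    by (simp add: cong_iff_dvd_diff)
  also have "of_int (b * (c * a) - a) = of_int b * (of_int (c * a) - padic_of_rat r :: 'p padic)"
    by (simp add: ra[symmetric] algebra_simps)
  finally have "padic_norm (padic_of_rat r - of_int (c * a) :: 'p padic) \<le> 1 / real CARD('p)"
    by (simp only: padic_norm_mult nb padic_norm_minus_commute[of "of_int (c * a)"] mult_1)
  from padic_norm_trans[OF less_imp_le[OF r] this] show ?thesis by (rule that)
qed


section \<open>Expanding maps with full branches\<close>

lemma powers_mult_bounded_imp_le_0:
  fixes lam :: real
  assumes "lam > 1" "\<And>n::nat. lam ^ n * d \<le> D"
  shows "d \<le> 0"
proof (rule ccontr)
  assume "\<not> d \<le> 0"
  then obtain n where "D / d < lam ^ n" using real_arch_pow[OF assms(1)] by blast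
  thus False using assms(2)[of n] \<open>\<not> d \<le> 0\<close> by (simp add: field_simps)
qed

text \<open>Nothing is said about \<open>f\<close> outside the pieces \<open>B i\<close>, so the
  value assigned at a pole never enters. Exact expansion, rather than a lower bound, provides both
  continuity of \<open>f\<close> on each piece and contraction of its inverse branches.\<close>

locale full_branches =
  fixes f :: "'a::complete_space \<Rightarrow> 'a" and B :: "nat \<Rightarrow> 'a set" and \<kappa> :: nat and lam D :: real
  assumes lam: "lam > 1"
    and closed_B: "\<And>i. i \<in> {1..\<kappa>} \<Longrightarrow> closed (B i)"
    and B_nonempty: "\<And>i. i \<in> {1..\<kappa>} \<Longrightarrow> B i \<noteq> {}"
    and disj: "\<And>i j. i \<in> {1..\<kappa>} \<Longrightarrow> j \<in> {1..\<kappa>} \<Longrightarrow> i \<noteq> j \<Longrightarrow> B i \<inter> B j = {}"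
    and diam: "\<And>i x y. i \<in> {1..\<kappa>} \<Longrightarrow> x \<in> B i \<Longrightarrow> y \<in> B i \<Longrightarrow> dist x y \<le> D"
    and expand: "\<And>i x y. i \<in> {1..\<kappa>} \<Longrightarrow> x \<in> B i \<Longrightarrow> y \<in> B i \<Longrightarrow> dist (f x) (f y) = lam * dist x y"
    and full: "\<And>i j. i \<in> {1..\<kappa>} \<Longrightarrow> j \<in> {1..\<kappa>} \<Longrightarrow> B j \<subseteq> f ` B i"
begin

section \<open>Points with a prescribed finite or infinite itinerary\<close>

definition follows :: "(nat \<Rightarrow> nat) \<Rightarrow> nat \<Rightarrow> 'a \<Rightarrow> bool" where
  "follows a N x \<longleftrightarrow> (\<forall>n\<le>N. (f ^^ n) x \<in> B (a n))"

lemma follows_mono: "follows a N x \<Longrightarrow> M \<le> N \<Longrightarrow> follows a M x"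
  by (auto simp: follows_def)

lemma follows_expand:
  assumes "range a \<subseteq> {1..\<kappa>}" "follows a N x" "follows a N y" "n \<le> N"
  shows "dist ((f ^^ n) x) ((f ^^ n) y) = lam ^ n * dist x y"
  using assms(4)
proof (induction n)
  case (Suc n)
  have "dist (f ((f ^^ n) x)) (f ((f ^^ n) y)) = lam * dist ((f ^^ n) x) ((f ^^ n) y)"
    using Suc.prems assms(1-3) by (intro expand[of "a n"]) (auto simp: follows_def image_subset_iff simp del: atLeastAtMost_iff)
  thus ?case using Suc by simp
qed simp

text \<open>After N steps both points still share a piece of diameter at most D, while their
  distance has grown by lam^N. Existence, uniqueness and continuity of the coding all rest on this
  shrinking of cylinders.\<close>

lemma follows_dist:
  assumes "range a \<subseteq> {1..\<kappa>}" "follows a N x" "follows a N y"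
  shows "lam ^ N * dist x y \<le> D"
proof -
  have "dist ((f ^^ N) x) ((f ^^ N) y) \<le> D"
    using assms by (intro diam[of "a N"]) (auto simp: follows_def image_subset_iff simp del: atLeastAtMost_iff)
  thus ?thesis using follows_expand[OF assms, of N] by simp
qed

text \<open>Backward construction: a point following the shifted code lies in
  \<open>B (a 1)\<close>, which is covered by the image of \<open>B (a 0)\<close>, and any preimage
  there follows the whole code. The code is therefore generalized in the induction.\<close>

lemma follows_exists:
  assumes "range a \<subseteq> {1..\<kappa>}"
  shows "\<exists>x. follows a N x"
  using assms
proof (induction N arbitrary: a)
  case 0
  hence "B (a 0) \<noteq> {}" by (intro B_nonempty) blast
  thus ?case by (auto simp: follows_def)
next
  case (Suc N)
  obtain y where y: "follows (\<lambda>n. a (Suc n)) N y"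
    using Suc.IH[of "\<lambda>n. a (Suc n)"] Suc.prems by blast
  hence "y \<in> B (a 1)" unfolding follows_def by (metis One_nat_def funpow_0 le0)
  then obtain x where x: "x \<in> B (a 0)" "y = f x"
    using subsetD[OF full[of "a 0" "a 1"], of y] Suc.prems by (auto simp del: atLeastAtMost_iff)
  have "(f ^^ n) x \<in> B (a n)" if "n \<le> Suc N" for n
  proof (cases n)
    case (Suc m)
    thus ?thesis using y x that by (auto simp: follows_def funpow_Suc_right simp del: funpow.simps)
  qed (use x in simp)
  thus ?case by (auto simp: follows_def)
qed

text \<open>Points following longer and longer prefixes form a Cauchy sequence by
  \<open>follows_dist\<close>, and closedness of the pieces passes the itinerary on to the
  limit.\<close>

lemma orbit_exists:
  assumes a: "range a \<subseteq> {1..\<kappa>}"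
  shows "\<exists>x. \<forall>n. (f ^^ n) x \<in> B (a n)"
proof -
  have a': "a n \<in> {1..\<kappa>}" for n using a by blast
  obtain x where x: "\<And>N. follows a N (x N)" using follows_exists[OF a] by metis
  have D: "dist (x m) (x n) \<le> D / lam ^ N" if "N \<le> m" "N \<le> n" for m n N
    using follows_dist[OF a, of N "x m" "x n"] follows_mono[OF x] that lam
    by (simp add: field_simps)
  have lim: "(\<lambda>N. D / lam ^ N) \<longlonglongrightarrow> 0"
    using tendsto_mult[OF tendsto_const LIMSEQ_inverse_realpow_zero[OF lam], of D]
    by (simp add: divide_inverse)
  have "Cauchy x"
  proof (rule metric_CauchyI)
    fix e :: real assume "e > 0"
    then obtain N where "D / lam ^ N < e"
      using order_tendstoD(2)[OF lim] by (metis eventually_sequentially order_refl)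
    thus "\<exists>M. \<forall>m\<ge>M. \<forall>n\<ge>M. dist (x m) (x n) < e"
      using D by (meson order_le_less_trans)
  qed
  then obtain l where l: "x \<longlonglongrightarrow> l" using Cauchy_convergent_iff convergent_def by blast
  \<comment> \<open>Membership and convergence are proved together: \<open>f\<close> is controlled
    only on the pieces, so the expansion identity applies at the n-th iterate of l only once that
    iterate is known to lie in \<open>B (a n)\<close>.\<close>
  have "(f ^^ n) l \<in> B (a n) \<and> (\<lambda>m. (f ^^ n) (x m)) \<longlonglongrightarrow> (f ^^ n) l" for n
  proof (induction n)
    case 0
    have "l \<in> B (a 0)"
      using x unfolding follows_def by (intro closed_sequentially[OF closed_B[OF a'] _ l]) (metis funpow_0 le0)
    thus ?case using l by simp
  next
    case (Suc n)
    have "\<forall>\<^sub>F m in sequentially. dist (f ((f ^^ n) (x m))) (f ((f ^^ n) l)) = lam * dist ((f ^^ n) (x m)) ((f ^^ n) l)"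
      using eventually_ge_at_top[of n]
    proof eventually_elim
      case (elim m)
      show ?case using expand[OF a'[of n], of "(f ^^ n) (x m)" "(f ^^ n) l"] Suc x[of m] elim
        by (simp add: follows_def)
    qed
    moreover have "(\<lambda>m. lam * dist ((f ^^ n) (x m)) ((f ^^ n) l)) \<longlonglongrightarrow> 0"
      using conjunct2[OF Suc] unfolding tendsto_dist_iff[of _ "(f ^^ n) l"]
      by (rule tendsto_mult_right_zero)
    ultimately have "(\<lambda>m. dist (f ((f ^^ n) (x m))) (f ((f ^^ n) l))) \<longlonglongrightarrow> 0"
      by (simp add: tendsto_cong)
    hence L: "(\<lambda>m. (f ^^ Suc n) (x m)) \<longlonglongrightarrow> (f ^^ Suc n) l"
      unfolding tendsto_dist_iff[of _ "(f ^^ Suc n) l"] by simp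
    have "\<forall>\<^sub>F m in sequentially. (f ^^ Suc n) (x m) \<in> B (a (Suc n))"
      using eventually_ge_at_top[of "Suc n"] by eventually_elim (use x in \<open>unfold follows_def, blast\<close>)
    hence "(f ^^ Suc n) l \<in> B (a (Suc n))"
      using Lim_in_closed_set[OF closed_B[OF a'] _ _ L] by simp
    thus ?case using L by simp
  qed
  thus ?thesis by blast
qed

lemma orbit_unique:
  assumes a: "range a \<subseteq> {1..\<kappa>}"
    and "\<And>n. (f ^^ n) x \<in> B (a n)" "\<And>n. (f ^^ n) y \<in> B (a n)"
  shows "x = y"
proof -
  have "dist x y \<le> 0"
    by (rule powers_mult_bounded_imp_le_0[OF lam, of _ D])
       (use assms in \<open>auto simp: follows_def intro!: follows_dist[OF a]\<close>)
  thus ?thesis by simp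
qed

text \<open>The inverse of the conjugacy. Going from codes to points puts the compact space on the
  domain side, so that continuity in this direction alone suffices.\<close>

definition point :: "(nat \<Rightarrow> nat) \<Rightarrow> 'a" where
  "point a = (THE x. \<forall>n. (f ^^ n) x \<in> B (a n))"

lemma point_eqI:
  assumes "range a \<subseteq> {1..\<kappa>}" "\<And>n. (f ^^ n) x \<in> B (a n)"
  shows "point a = x"
  unfolding point_def using assms(2) by (intro the_equality allI orbit_unique[OF assms(1)]) blast+

lemma point_orbit:
  assumes "range a \<subseteq> {1..\<kappa>}"
  shows "(f ^^ n) (point a) \<in> B (a n)"
proof -
  obtain x where x: "\<And>n. (f ^^ n) x \<in> B (a n)" using orbit_exists[OF assms] by blast
  thus ?thesis using point_eqI[OF assms x] by simp
qed

lemma point_shift: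
  assumes "range a \<subseteq> {1..\<kappa>}"
  shows "point (left_shift a) = f (point a)"
proof (rule point_eqI)
  show "(f ^^ n) (f (point a)) \<in> B (left_shift a n)" for n
    using point_orbit[OF assms, of "Suc n"]
    by (simp add: left_shift_def funpow_Suc_right del: funpow.simps)
qed (use assms in \<open>auto simp: left_shift_def image_subset_iff\<close>)

section \<open>The homeomorphism with the shift space\<close>

lemma topspace_full_shift: "topspace (full_shift_space \<kappa>) = {a. range a \<subseteq> {1..\<kappa>}}"
  by (simp add: full_shift_space_def PiE_def Pi_def image_subset_iff)

text \<open>\<open>point\<close> is a continuous bijection from a compact space, a product of finite
  discrete ones, onto the Hausdorff space J, hence a homeomorphism. Its inverse h reads off
  itineraries, and \<open>point_shift\<close> becomes the conjugacy equation.\<close>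

theorem conjugate_to_full_shift:
  defines "J \<equiv> julia_set f (\<Union>i\<in>{1..\<kappa>}. B i)"
  shows "\<exists>h. homeomorphic_map (top_of_set J) (full_shift_space \<kappa>) h \<and>
             (\<forall>x\<in>J. h (f x) = left_shift (h x))"
proof -
  let ?S = "full_shift_space \<kappa>"
  have S: "range a \<subseteq> {1..\<kappa>}" if "a \<in> topspace ?S" for a
    using that unfolding topspace_full_shift by blast
  hence Sn: "a n \<in> {1..\<kappa>}" if "a \<in> topspace ?S" for a n
    using that by blast
  have im: "point ` topspace ?S = J"
  proof safe
    fix a assume a: "a \<in> topspace ?S"
    show "point a \<in> J"
      unfolding J_def julia_set_def using point_orbit[OF S[OF a]] Sn[OF a] by blast
  next
    fix x assume "x \<in> J"
    hence "\<forall>n. \<exists>i. i \<in> {1..\<kappa>} \<and> (f ^^ n) x \<in> B i" unfolding J_def julia_set_def by blast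
    then obtain a where a: "\<And>n. a n \<in> {1..\<kappa>}" "\<And>n. (f ^^ n) x \<in> B (a n)" by metis
    hence "range a \<subseteq> {1..\<kappa>}" by blast
    note a = this a(2)
    thus "x \<in> point ` topspace ?S"
      using point_eqI[OF a] unfolding topspace_full_shift by blast
  qed
  have inj: "inj_on point (topspace ?S)"
  proof (rule inj_onI, rule ext)
    fix a b n assume ab: "a \<in> topspace ?S" "b \<in> topspace ?S" "point a = point b"
    have "(f ^^ n) (point a) \<in> B (a n) \<inter> B (b n)"
      using point_orbit[OF S[OF ab(1)], of n] point_orbit[OF S[OF ab(2)], of n] ab(3) by auto
    thus "a n = b n" using disj[OF Sn[OF ab(1)] Sn[OF ab(2)]] by blast
  qed
  have "continuous_map ?S Met_TC.mtopology point"
    unfolding Met_TC.continuous_map_to_metric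
  proof (intro ballI allI impI)
    fix a and e :: real assume a: "a \<in> topspace ?S" and e: "e > 0"
    obtain N where N: "D / e < lam ^ N" using real_arch_pow[OF lam] by blast
    \<comment> \<open>The cylinder of codes agreeing with a up to N. It restricts finitely many
      coordinates, hence is open, and the choice of N makes its image smaller than e.\<close>
    define U where "U = {b \<in> topspace ?S. \<forall>n\<le>N. b n = a n}"
    have "U = PiE UNIV (\<lambda>n. if n \<le> N then {a n} else {1..\<kappa>})"
      unfolding U_def topspace_full_shift using Sn[OF a]
      by (auto simp: PiE_iff image_subset_iff simp del: atLeastAtMost_iff split: if_splits)
    moreover have "openin ?S \<dots>"
      unfolding full_shift_space_def
      by (rule product_topology_basis) (use Sn[OF a] in \<open>auto simp del: atLeastAtMost_iff intro: finite_subset[of _ "{..N}"]\<close>)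
    ultimately have "openin ?S U" by simp
    moreover have "point b \<in> ball (point a) e" if "b \<in> U" for b
    proof -
      have b: "b \<in> topspace ?S" "\<And>n. n \<le> N \<Longrightarrow> b n = a n" using that by (auto simp: U_def)
      have "follows a N (point b)" "follows a N (point a)"
        using point_orbit[OF S[OF a]] point_orbit[OF S[OF b(1)]] b(2) unfolding follows_def by metis+
      hence "lam ^ N * dist (point a) (point b) \<le> D" using follows_dist[OF S[OF a]] by blast
      also have "D < lam ^ N * e" using N e by (simp add: field_simps)
      finally show ?thesis using lam by simp
    qed
    moreover have "a \<in> U" using a by (simp add: U_def)
    ultimately show "\<exists>U. openin ?S U \<and> a \<in> U \<and> (\<forall>y\<in>U. point y \<in> Met_TC.mball (point a) e)"
      by auto
  qed
  hence "continuous_map ?S (top_of_set J) point"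
    using im by (auto simp: continuous_map_in_subtopology)
  moreover have "compact_space ?S"
    by (auto simp: full_shift_space_def compact_space_product_topology compact_space_discrete_topology)
  moreover have "Hausdorff_space (top_of_set J)"
    by (rule Hausdorff_space_subtopology) simp
  ultimately have "homeomorphic_map ?S (top_of_set J) point"
    using im inj by (intro continuous_imp_homeomorphic_map) auto
  then obtain h where h: "homeomorphic_maps ?S (top_of_set J) point h"
    by (auto simp: homeomorphic_map_maps)
  have "homeomorphic_map (top_of_set J) ?S h"
    using h homeomorphic_maps_map by blast
  moreover have "h (f x) = left_shift (h x)" if x: "x \<in> J" for x
  proof -
    obtain a where a: "a \<in> topspace ?S" "x = point a" using x im by blast
    have inv: "h (point b) = b" if "b \<in> topspace ?S" for b
      using h that by (auto simp: homeomorphic_maps_def)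
    have "left_shift a \<in> topspace ?S"
      using S[OF a(1)] unfolding topspace_full_shift by (auto simp: left_shift_def)
    thus ?thesis using inv point_shift[OF S[OF a(1)]] a by metis
  qed
  ultimately show ?thesis by blast
qed

end


section \<open>The power map\<close>

text \<open>The principal units 1 + p Z_p, where the linear term governs the binomial
  expansion.\<close>

definition padic_one_unit :: "'p::prime_card padic \<Rightarrow> bool" where
  "padic_one_unit a \<longleftrightarrow> padic_norm (a - 1) \<le> 1 / real CARD('p)"

section \<open>The power map on principal units\<close>

lemma padic_norm_near:
  fixes x y :: "'p::prime_card padic"
  assumes "padic_norm (x - y) \<le> padic_norm y / real CARD('p)" "y \<noteq> 0"
  shows "padic_norm x = padic_norm y"
proof (rule padic_norm_dominant)
  have "padic_norm y > 0" using assms(2) by simp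
  hence "padic_norm y / real CARD('p) < padic_norm y"
    using one_less_prime_card[where 'p='p] by (simp add: field_simps)
  thus "padic_norm (x - y) < padic_norm y" using assms(1) by linarith
qed

lemma padic_one_unit_norm: "padic_one_unit a \<Longrightarrow> padic_norm a = 1"
  using padic_norm_near[of a 1] by (simp add: padic_one_unit_def)

lemma padic_one_unit_power: "padic_one_unit a \<Longrightarrow> padic_one_unit (a ^ n)"
proof (induction n)
  case 0
  thus ?case by (simp add: padic_one_unit_def)
next
  case (Suc n)
  have eq: "a ^ Suc n - 1 = a * (a ^ n - 1) + (a - 1)" by (simp add: algebra_simps)
  show ?case using Suc padic_one_unit_norm[OF Suc.prems] unfolding padic_one_unit_def eq
    by (intro padic_norm_add_le) (simp_all add: padic_norm_mult)
qed

lemma padic_norm_power_diff_le: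
  assumes "padic_norm x \<le> 1" "padic_norm y \<le> 1"
  shows "padic_norm (x ^ n - y ^ n) \<le> padic_norm (x - y)"
proof (induction n)
  case (Suc n)
  have "x ^ Suc n - y ^ Suc n = x * (x ^ n - y ^ n) + (x - y) * y ^ n" by (simp add: algebra_simps)
  moreover have "padic_norm (x * (x ^ n - y ^ n)) \<le> padic_norm (x - y)"
    using Suc assms by (simp add: padic_norm_mult) (meson mult_left_le_one_le order_trans padic_norm_nonneg)
  moreover have "padic_norm ((x - y) * y ^ n) \<le> padic_norm (x - y)"
    using assms by (simp add: padic_norm_mult padic_norm_power mult_left_le power_le_one)
  ultimately show ?case by (simp add: padic_norm_add_le)
qed simp

text \<open>Serves to show that p^m dividing j forces m <= j - 2. The inequality fails for p = 2 and
  j = 2; here the assumption of an odd prime enters.\<close>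

lemma less_power_minus_1:
  assumes "3 \<le> (p::nat)" "2 \<le> j"
  shows "j < p ^ (j - 1)"
  using assms(2)
proof (induction j rule: nat_induct_at_least)
  case base
  thus ?case using assms(1) by simp
next
  case (Suc j)
  have "Suc j \<le> 3 * j" using Suc by simp
  also have "\<dots> < 3 * p ^ (j - 1)" using Suc by simp
  also have "\<dots> \<le> p * p ^ (j - 1)" using assms(1) by simp
  also have "\<dots> = p ^ (Suc j - 1)" using Suc by (simp flip: power_Suc)
  finally show ?case .
qed

lemma padic_norm_of_nat_ge:
  assumes "3 \<le> CARD('p::prime_card)" "2 \<le> j"
  shows "1 / real CARD('p) ^ (j - 2) \<le> padic_norm (of_nat j :: 'p padic)"
proof -
  define m where "m = multiplicity (int CARD('p)) (int j)"
  have "int CARD('p) ^ m dvd int j" unfolding m_def by (rule multiplicity_dvd)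
  hence "CARD('p) ^ m dvd j" by (metis int_dvd_int_iff of_nat_power)
  hence "CARD('p) ^ m \<le> j" using assms by (intro dvd_imp_le) auto
  also have "j < CARD('p) ^ (j - 1)" using assms by (rule less_power_minus_1)
  finally have "m < j - 1" using assms(1) by (subst (asm) power_strict_increasing_iff) auto
  hence "real CARD('p) ^ m \<le> real CARD('p) ^ (j - 2)"
    using assms by (intro power_increasing) auto
  thus ?thesis
    using padic_norm_of_int[of "int j", where 'p='p] assms one_less_prime_card[where 'p='p]
    by (simp add: m_def frac_le)
qed

text \<open>Expand a^k = (b + d)^k with |d| <= 1/p. In the term of degree j >= 2 the binomial
  coefficient has norm at most |k|/|j| <= |k| p^(j-2), whereas d^(j-1) contributes at most
  p^(-(j-1)); a factor 1/p beyond |k| |d| remains.\<close>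

lemma padic_power_approx:
  fixes a b :: "'p::prime_card padic"
  assumes p3: "3 \<le> CARD('p)" and a: "padic_one_unit a" and b: "padic_one_unit b"
  shows "padic_norm (a ^ k - b ^ k - of_nat k * (a - b)) \<le>
    padic_norm (of_nat k :: 'p padic) * padic_norm (a - b) / real CARD('p)"
proof (cases "k = 0")
  case False
  define P where "P = real CARD('p)"
  have P: "P > 1" using one_less_prime_card[where 'p='p] by (simp add: P_def)
  define d where "d = a - b"
  have d: "padic_norm d \<le> 1 / P"
    using padic_norm_diff_le[of "a - 1" "1 / P" "b - 1"] a b by (simp add: padic_one_unit_def P_def d_def)
  define T where "T j = of_nat (k choose j) * d ^ j * b ^ (k - j)" for j
  have sub: "{..k} = insert 0 (insert 1 {2..k})" using False by auto
  have "a ^ k = (\<Sum>j\<le>k. T j)"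
    using binomial_ring[of d b k] by (simp add: d_def T_def)
  also have "\<dots> = b ^ k + of_nat k * d * b ^ (k - 1) + (\<Sum>j=2..k. T j)"
    unfolding sub by (simp add: T_def algebra_simps)
  \<comment> \<open>Replacing b^(k-1) by 1 in the linear term costs only a factor 1/p, because
    b^(k-1) is again a principal unit.\<close>
  finally have eq: "a ^ k - b ^ k - of_nat k * (a - b) =
      of_nat k * d * (b ^ (k - 1) - 1) + (\<Sum>j=2..k. T j)"
    by (simp add: algebra_simps d_def)
  let ?e = "padic_norm (of_nat k :: 'p padic) * padic_norm d / P"
  have "padic_norm (of_nat k * d * (b ^ (k - 1) - 1)) \<le> ?e"
    using mult_left_mono[OF padic_one_unit_power[OF b, of "k - 1", unfolded padic_one_unit_def],
        of "padic_norm (of_nat k :: 'p padic) * padic_norm d"]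
    by (simp add: padic_norm_mult P_def)
  moreover have "padic_norm (T j) \<le> ?e" if j: "j \<in> {2..k}" for j
  proof -
    let ?C = "padic_norm (of_nat (k choose j) :: 'p padic)"
    \<comment> \<open>This identity makes k, divided by j, visible in the binomial
      coefficient.\<close>
    have "j * (k choose j) = k * ((k - 1) choose (j - 1))"
      using times_binomial_minus1_eq[of j k] j by simp
    hence "of_nat j * of_nat (k choose j) = (of_nat k * of_nat ((k - 1) choose (j - 1)) :: 'p padic)"
      by (metis of_nat_mult)
    hence "padic_norm (of_nat j :: 'p padic) * ?C \<le> padic_norm (of_nat k :: 'p padic)"
      by (metis padic_norm_mult padic_norm_of_nat_le_1 mult_left_le padic_norm_nonneg)
    moreover have "1 / P ^ (j - 2) * ?C \<le> padic_norm (of_nat j :: 'p padic) * ?C"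
      using padic_norm_of_nat_ge[OF p3, of j] j by (intro mult_right_mono) (auto simp: P_def)
    ultimately have "1 / P ^ (j - 2) * ?C \<le> padic_norm (of_nat k :: 'p padic)" by linarith
    hence C: "?C \<le> padic_norm (of_nat k :: 'p padic) * P ^ (j - 2)"
      using P by (simp add: divide_le_eq)
    have "padic_norm d ^ j = padic_norm d * padic_norm d ^ (j - 1)"
      using j by (simp flip: power_Suc)
    also have "\<dots> \<le> padic_norm d * (1 / P) ^ (j - 1)"
      using d by (intro mult_left_mono power_mono) auto
    finally have D: "padic_norm d ^ j \<le> padic_norm d * (1 / P) ^ (j - 1)" .
    have "padic_norm (T j) = ?C * padic_norm d ^ j"
      using padic_one_unit_norm[OF b] by (simp add: T_def padic_norm_mult padic_norm_power)
    also have "\<dots> \<le> (padic_norm (of_nat k :: 'p padic) * P ^ (j - 2)) * (padic_norm d * (1 / P) ^ (j - 1))"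
      using C D P by (intro mult_mono) auto
    also have "\<dots> = padic_norm (of_nat k :: 'p padic) * padic_norm d * (P ^ (j - 2) * (1 / P) ^ (j - 1))"
      by simp
    also have "P ^ (j - 2) * (1 / P) ^ (j - 1) = 1 / P"
    proof -
      have "j - 1 = Suc (j - 2)" using j by auto
      thus ?thesis using P by (simp add: power_one_over field_simps)
    qed
    finally show ?thesis by simp
  qed
  hence "padic_norm (\<Sum>j=2..k. T j) \<le> ?e" using P by (intro padic_norm_sum_le) auto
  ultimately have "padic_norm (a ^ k - b ^ k - of_nat k * (a - b)) \<le> ?e"
    unfolding eq by (rule padic_norm_add_le)
  thus ?thesis by (simp add: d_def P_def)
qed simp

text \<open>The error in \<open>padic_power_approx\<close> is strictly below the linear term, which
  therefore determines the norm. If the linear term vanishes, the same bound forces a^k =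
  b^k.\<close>

lemma padic_one_unit_power_dist:
  fixes a b :: "'p::prime_card padic"
  assumes "3 \<le> CARD('p)" "padic_one_unit a" "padic_one_unit b"
  shows "padic_norm (a ^ k - b ^ k) = padic_norm (of_nat k :: 'p padic) * padic_norm (a - b)"
proof (cases "of_nat k * (a - b) = 0")
  case True
  hence "padic_norm (a ^ k - b ^ k) \<le> 0"
    using padic_power_approx[OF assms, of k] unfolding padic_norm_mult[symmetric] True by simp
  hence "padic_norm (a ^ k - b ^ k) = 0" by (intro antisym) simp_all
  thus ?thesis by (simp add: True flip: padic_norm_mult)
next
  case False
  thus ?thesis
    using padic_norm_near[of "a ^ k - b ^ k" "of_nat k * (a - b)"] padic_power_approx[OF assms, of k]
    by (simp add: padic_norm_mult)
qed

lemma padic_norm_of_nat_pos: "k > 0 \<Longrightarrow> padic_norm (of_nat k :: 'p::prime_card padic) > 0"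
  using padic_norm_of_int[of "int k", where 'p='p] one_less_prime_card[where 'p='p] by simp

text \<open>Newton iteration with constant slope k: T a = a - (a^k - c)/k contracts the principal
  units by 1/p because of \<open>padic_power_approx\<close>, and its fixed point is a k-th root of
  c.\<close>

lemma padic_one_unit_power_surj:
  fixes c :: "'p::prime_card padic"
  assumes p3: "3 \<le> CARD('p)" and k: "k > 0"
    and c: "padic_norm (c - 1) \<le> padic_norm (of_nat k :: 'p padic) / real CARD('p)"
  obtains a where "padic_one_unit a" "a ^ k = c"
proof -
  define P where "P = real CARD('p)"
  have P: "P > 1" using one_less_prime_card[where 'p='p] by (simp add: P_def)
  define K :: "'p padic" where "K = of_nat k"
  have K: "padic_norm K > 0" unfolding K_def using k by (rule padic_norm_of_nat_pos)
  hence K0: "K \<noteq> 0" by auto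
  define S where "S = {a :: 'p padic. padic_one_unit a}"
  have S: "S = cball 1 (1 / P)"
    by (auto simp: S_def padic_one_unit_def P_def dist_padic_def padic_norm_minus_commute)
  define T where "T a = a - (a ^ k - c) / K" for a
  have diff: "padic_norm (T a - T b) \<le> 1 / P * padic_norm (a - b)" if "a \<in> S" "b \<in> S" for a b
  proof -
    have "T a - T b = - ((a ^ k - b ^ k - K * (a - b)) / K)"
      using K0 by (simp add: T_def field_simps)
    hence "padic_norm (T a - T b) = padic_norm (a ^ k - b ^ k - K * (a - b)) / padic_norm K"
      by (simp only: padic_norm_minus padic_norm_divide)
    also have "\<dots> \<le> (padic_norm K * padic_norm (a - b) / P) / padic_norm K"
      using padic_power_approx[OF p3, of a b k] that K
      by (intro divide_right_mono) (auto simp: S_def K_def P_def)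
    also have "\<dots> = 1 / P * padic_norm (a - b)" using K0 by simp
    finally show ?thesis .
  qed
  have one: "1 \<in> S" using P by (simp add: S)
  have "\<exists>!a\<in>S. T a = a"
  proof (rule Banach_fix[where c = "1 / P"])
    show "complete S" by (simp add: S complete_eq_closed)
    show "S \<noteq> {}" using one by blast
    show "0 \<le> 1 / P" "1 / P < 1" using P by auto
    show "dist (T a) (T b) \<le> 1 / P * dist a b" if "a \<in> S" "b \<in> S" for a b
      using diff[OF that] by (simp add: dist_padic_def)
    show "T ` S \<subseteq> S"
    proof safe
      fix a assume a: "a \<in> S"
      have "padic_norm (a - 1) \<le> 1 / P" using a by (simp add: S_def padic_one_unit_def P_def)
      hence "1 / P * padic_norm (a - 1) \<le> 1 / P * 1"
        using P by (intro mult_left_mono) (auto intro: order_trans)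
      hence 1: "padic_norm (T a - T 1) \<le> 1 / P" using diff[OF a one] by linarith
      \<comment> \<open>The bound on c is exactly what keeps T 1, and with it the image of T, inside
        the principal units.\<close>
      have "T 1 - 1 = (c - 1) / K" by (simp add: T_def diff_divide_distrib)
      hence "padic_norm (T 1 - 1) = padic_norm (c - 1) / padic_norm K" by (simp add: padic_norm_divide)
      also have "\<dots> \<le> (padic_norm K / P) / padic_norm K"
        using c K by (intro divide_right_mono) (auto simp: K_def P_def)
      also have "\<dots> = 1 / P" using K0 by simp
      finally show "T a \<in> S" using padic_norm_trans[OF 1] by (simp add: S_def padic_one_unit_def P_def)
    qed
  qed
  then obtain a where "a \<in> S" "T a = a" by blast
  thus ?thesis using that[of a] K0 by (simp add: T_def S_def)
qed

section \<open>Power maps on balls around an arbitrary nonzero point, by rescaling\<close>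

lemma padic_one_unit_divide:
  fixes a b :: "'p::prime_card padic"
  assumes "padic_norm (a - b) \<le> padic_norm b / real CARD('p)" "b \<noteq> 0"
  shows "padic_one_unit (a / b)"
proof -
  have "padic_norm b > 0" using assms(2) by simp
  moreover have "a / b - 1 = (a - b) / b" using assms(2) by (simp add: field_simps)
  ultimately show ?thesis using assms(1)
    unfolding padic_one_unit_def by (simp add: padic_norm_divide field_simps)
qed

lemma padic_power_dist:
  fixes a b c :: "'p::prime_card padic"
  assumes p3: "3 \<le> CARD('p)" and k: "k > 0" and c: "c \<noteq> 0"
    and a: "padic_norm (a - c) \<le> padic_norm c / real CARD('p)"
    and b: "padic_norm (b - c) \<le> padic_norm c / real CARD('p)"
  shows "padic_norm (a ^ k - b ^ k) =
    padic_norm (of_nat k :: 'p padic) * padic_norm c ^ (k - 1) * padic_norm (a - b)"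
proof -
  have c0: "padic_norm c > 0" using c by simp
  have "a ^ k - b ^ k = c ^ k * ((a / c) ^ k - (b / c) ^ k)"
    using c by (simp add: field_simps)
  hence "padic_norm (a ^ k - b ^ k) = padic_norm c ^ k *
      (padic_norm (of_nat k :: 'p padic) * padic_norm (a / c - b / c))"
    using padic_one_unit_power_dist[OF p3 padic_one_unit_divide[OF a c] padic_one_unit_divide[OF b c], of k]
    by (simp add: padic_norm_mult padic_norm_power)
  also have "padic_norm (a / c - b / c) = padic_norm (a - b) / padic_norm c"
    by (simp add: padic_norm_divide flip: diff_divide_distrib)
  also have "padic_norm c ^ k = padic_norm c ^ (k - 1) * padic_norm c"
    using k by (simp flip: power_Suc2)
  finally show ?thesis using c by simp
qed

lemma padic_power_surj:
  fixes c v :: "'p::prime_card padic"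
  assumes p3: "3 \<le> CARD('p)" and k: "k > 0" and c: "c \<noteq> 0"
    and v: "padic_norm (v - c ^ k) \<le> padic_norm (of_nat k :: 'p padic) * padic_norm c ^ k / real CARD('p)"
  obtains a where "padic_norm (a - c) \<le> padic_norm c / real CARD('p)" "a ^ k = v"
proof -
  have c0: "padic_norm c > 0" using c by simp
  have "v / c ^ k - 1 = (v - c ^ k) / c ^ k" using c by (simp add: field_simps)
  hence "padic_norm (v / c ^ k - 1) = padic_norm (v - c ^ k) / padic_norm c ^ k"
    by (simp add: padic_norm_divide padic_norm_power)
  also have "\<dots> \<le> padic_norm (of_nat k :: 'p padic) / real CARD('p)"
    using v c0 by (simp add: field_simps)
  finally obtain a where a: "padic_one_unit a" "a ^ k = v / c ^ k"
    by (rule padic_one_unit_power_surj[OF p3 k])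
  have "a * c - c = (a - 1) * c" by (simp add: algebra_simps)
  hence "padic_norm (a * c - c) \<le> padic_norm c / real CARD('p)"
    using mult_right_mono[of "padic_norm (a - 1)" "1 / real CARD('p)" "padic_norm c"] a(1)
    by (simp add: padic_norm_mult padic_one_unit_def)
  moreover have "(a * c) ^ k = v" using a(2) c by (simp add: power_mult_distrib)
  ultimately show ?thesis by (rule that)
qed

section \<open>Roots of unity and the correction of k-th roots\<close>

lemma padic_fermat:
  fixes x :: "'p::prime_card padic"
  assumes "padic_norm x \<le> 1"
  shows "padic_norm (x ^ CARD('p) - x) \<le> 1 / real CARD('p)"
proof -
  let ?P = "1 / real CARD('p)"
  obtain n where n: "padic_norm (x - of_int n) \<le> ?P" using assms by (rule padic_residue)
  \<comment> \<open>A natural representative of the residue, since \<open>fermat_theorem\<close>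
    concerns natural numbers.\<close>
  define N where "N = nat (n mod int CARD('p))"
  have "[N ^ CARD('p) = N] (mod CARD('p))"
  proof (cases "CARD('p) dvd N")
    case True
    moreover have "N dvd N ^ CARD('p)" by (simp add: dvd_power)
    ultimately have "CARD('p) dvd N ^ CARD('p)" by (rule dvd_trans)
    thus ?thesis using True by (simp add: cong_def dvd_imp_mod_0)
  next
    case False
    have "[N ^ (CARD('p) - 1) * N = 1 * N] (mod CARD('p))"
      by (intro cong_scalar_right fermat_theorem prime_card False)
    thus ?thesis by (simp flip: power_Suc2)
  qed
  hence "[int N ^ CARD('p) = int N] (mod int CARD('p))" by (metis cong_int_iff of_nat_power)
  moreover have "[int N = n] (mod int CARD('p))" by (simp add: N_def)
  ultimately have "[n ^ CARD('p) = n] (mod int CARD('p))"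
    using cong_trans[OF cong_sym[OF cong_pow[of "int N" n _ "CARD('p)"]]] cong_trans by blast
  hence "int CARD('p) dvd n ^ CARD('p) - n" by (simp add: cong_iff_dvd_diff)
  hence "padic_norm (of_int (n ^ CARD('p) - n) :: 'p padic) \<le> ?P"
    using padic_norm_of_int_le_iff[of "n ^ CARD('p) - n" 1, where 'p='p] by simp
  hence 1: "padic_norm (of_int n ^ CARD('p) - of_int n :: 'p padic) \<le> ?P" by simp
  have 2: "padic_norm (x ^ CARD('p) - of_int n ^ CARD('p)) \<le> ?P"
    using padic_norm_power_diff_le[OF assms padic_norm_of_int_le_1, of "CARD('p)" n] n by linarith
  show ?thesis
    using padic_norm_trans[OF padic_norm_trans[OF 2 1], of x] n by (simp add: padic_norm_minus_commute)
qed

text \<open>w is the Teichmueller representative of x: as |p| = 1/p, the p-th power map contracts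
  the ball around x, which it preserves by \<open>padic_fermat\<close>, and w is its fixed
  point.\<close>

lemma padic_root_of_unity_near:
  fixes x :: "'p::prime_card padic"
  assumes p3: "3 \<le> CARD('p)" and x: "padic_norm x = 1" and xk: "padic_one_unit (x ^ k)"
  obtains w where "padic_norm (w - x) \<le> 1 / real CARD('p)" "w ^ k = 1"
proof -
  define P where "P = real CARD('p)"
  have P: "P > 1" using one_less_prime_card[where 'p='p] by (simp add: P_def)
  have x0: "x \<noteq> 0" using x by auto
  define S where "S = {a. padic_norm (a - x) \<le> 1 / P}"
  have S: "S = cball x (1 / P)"
    by (auto simp: S_def dist_padic_def padic_norm_minus_commute)
  have diff: "padic_norm (a ^ CARD('p) - b ^ CARD('p)) = 1 / P * padic_norm (a - b)"
    if "a \<in> S" "b \<in> S" for a b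
    using padic_power_dist[OF p3 _ x0, of "CARD('p)" a b] that x
    by (simp add: S_def P_def padic_norm_prime_card)
  have "\<exists>!w\<in>S. w ^ CARD('p) = w"
  proof (rule Banach_fix[where c = "1 / P"])
    show "complete S" by (simp add: S complete_eq_closed)
    show "S \<noteq> {}" using P by (auto simp: S)
    show "0 \<le> 1 / P" "1 / P < 1" using P by auto
    show "dist (a ^ CARD('p)) (b ^ CARD('p)) \<le> 1 / P * dist a b" if "a \<in> S" "b \<in> S" for a b
      using diff[OF that] by (simp add: dist_padic_def)
    show "(\<lambda>w. w ^ CARD('p)) ` S \<subseteq> S"
    proof safe
      fix a assume a: "a \<in> S"
      hence "padic_norm a = 1"
        using padic_norm_near[of a x] x x0 by (simp add: S_def P_def)
      hence "padic_norm (a ^ CARD('p) - a) \<le> 1 / P"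
        unfolding P_def by (intro padic_fermat) simp
      thus "a ^ CARD('p) \<in> S" using padic_norm_trans[of "a ^ CARD('p)" a "1 / P" x] a by (simp add: S_def)
    qed
  qed
  then obtain w where w: "w \<in> S" "w ^ CARD('p) = w" by blast
  have nw: "padic_norm w = 1" using padic_norm_near[of w x] x x0 w(1) by (simp add: S_def P_def)
  have "padic_norm (w ^ k - x ^ k) \<le> 1 / P"
    using padic_norm_power_diff_le[of w x k] nw x w(1) by (simp add: S_def)
  hence one: "padic_one_unit (w ^ k)"
    using padic_norm_trans[of "w ^ k" "x ^ k" "1 / P" 1] xk by (simp add: padic_one_unit_def P_def)
  have "(w ^ k) ^ CARD('p) = w ^ k"
    using w(2) by (metis power_commutes power_mult mult.commute)
  \<comment> \<open>Both w^k and 1 are principal units fixed by the p-th power map, which shrinks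
    their distance by 1/p; so they coincide.\<close>
  hence "padic_norm (w ^ k - 1) = 1 / P * padic_norm (w ^ k - 1)"
    using padic_one_unit_power_dist[OF p3 one, of 1 "CARD('p)"] P
    by (simp add: padic_one_unit_def padic_norm_prime_card P_def)
  hence "padic_norm (w ^ k - 1) * (P - 1) = 0" using P by (simp add: field_simps)
  hence "w ^ k = 1" using P by simp
  thus ?thesis using that[of w] w(1) by (simp add: S_def P_def)
qed

text \<open>x/y is a unit whose k-th power is a principal unit. A root of unity w near x/y turns the
  known root y into w y near x. Starting from a known root, closeness is needed only up to 1/p, with
  no factor |k| as in a Hensel argument.\<close>

lemma padic_root_near:
  fixes y x :: "'p::prime_card padic"
  assumes p3: "3 \<le> CARD('p)" and y: "y \<noteq> 0" and nx: "padic_norm x = padic_norm y"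
    and xk: "padic_norm (x ^ k - y ^ k) \<le> padic_norm y ^ k / real CARD('p)"
  obtains z where "padic_norm (z - x) \<le> padic_norm x / real CARD('p)" "z ^ k = y ^ k"
proof -
  have y0: "padic_norm y > 0" using y by simp
  have "padic_one_unit ((x / y) ^ k)"
    using padic_one_unit_divide[of "x ^ k" "y ^ k"] xk y by (simp add: power_divide padic_norm_power)
  moreover have "padic_norm (x / y) = 1" using nx y by (simp add: padic_norm_divide)
  ultimately obtain w where w: "padic_norm (w - x / y) \<le> 1 / real CARD('p)" "w ^ k = 1"
    using padic_root_of_unity_near[OF p3] by blast
  have "w * y - x = (w - x / y) * y" using y by (simp add: field_simps)
  hence "padic_norm (w * y - x) \<le> padic_norm x / real CARD('p)"
    using mult_right_mono[OF w(1), of "padic_norm y"] nx by (simp add: padic_norm_mult)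
  moreover have "(w * y) ^ k = y ^ k" using w(2) by (simp add: power_mult_distrib)
  ultimately show ?thesis by (rule that)
qed


section \<open>The branches of the Potts--Bethe mapping\<close>

definition potts_moebius :: "int \<Rightarrow> 'p::prime_card padic \<Rightarrow> 'p padic \<Rightarrow> 'p padic" where
  "potts_moebius q \<theta> t = (\<theta> * t + 1 - of_int q) / (t + 1)"

text \<open>The factor theta - 1 cancels from numerator and denominator. The identity also holds at
  the pole t = -1, where both quotients are 0 by convention.\<close>

lemma potts_bethe_rescaled:
  fixes \<theta> :: "'p::prime_card padic"
  assumes "\<theta> \<noteq> 1"
  shows "potts_bethe k q \<theta> (1 - of_int q + (\<theta> - 1) * t) = potts_moebius q \<theta> t ^ k"
proof -
  have "\<theta> * (1 - of_int q + (\<theta> - 1) * t) + of_int q - 1 = (\<theta> - 1) * (\<theta> * t + 1 - of_int q)"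
    by (simp add: algebra_simps)
  moreover have "1 - of_int q + (\<theta> - 1) * t + \<theta> + of_int q - 2 = (\<theta> - 1) * (t + 1)"
    by (simp add: algebra_simps)
  ultimately show ?thesis using assms unfolding potts_bethe_def potts_moebius_def by simp
qed

text \<open>One branch: y is the k-th root of 1 - q belonging to it and t0 the rescaled centre,
  which the Moebius map sends close to y, not necessarily to y itself.\<close>

locale potts_branch =
  fixes \<theta> :: "'p::prime_card padic" and q :: int and k :: nat and y t0 :: "'p padic"
  assumes p3: "3 \<le> CARD('p)" and k: "k > 0"
    and q: "padic_norm (of_int q :: 'p padic) = 1"
    and \<theta>: "padic_norm (\<theta> - 1) \<le> 1 / real CARD('p)" "\<theta> \<noteq> 1"
    and y: "y \<noteq> 0" "padic_norm y \<le> 1" "y ^ k = 1 - of_int q"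
    and t0: "padic_norm (t0 + 1) = 1"
      "padic_norm (potts_moebius q \<theta> t0 - y) \<le> padic_norm y / real CARD('p)"
begin

text \<open>The ball of this radius around y consists of the products of y with principal
  units.\<close>

definition \<rho> :: real where "\<rho> = padic_norm y / real CARD('p)"

lemma \<rho>_le: "\<rho> \<le> 1 / real CARD('p)" and \<rho>_less: "\<rho> < 1" and \<rho>_pos: "\<rho> > 0"
proof -
  show le: "\<rho> \<le> 1 / real CARD('p)"
    using y(2) by (simp add: \<rho>_def divide_right_mono)
  have "1 / real CARD('p) < 1" using one_less_prime_card[where 'p='p] by simp
  thus "\<rho> < 1" using le by linarith
  show "\<rho> > 0" using y(1) one_less_prime_card[where 'p='p] by (simp add: \<rho>_def)
qed

lemma det_norm: "padic_norm (\<theta> - 1 + of_int q) = 1"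
  using padic_norm_near[of "\<theta> - 1 + of_int q" "of_int q"] q \<theta>(1) by fastforce

lemma norm_plus_1:
  assumes "padic_norm (t - t0) \<le> \<rho>"
  shows "padic_norm (t + 1) = 1"
proof -
  have "padic_norm ((t + 1) - (t0 + 1)) < padic_norm (t0 + 1)"
    using assms \<rho>_less t0(1) by simp
  thus ?thesis using padic_norm_dominant t0(1) by metis
qed

text \<open>The difference of two values is the determinant times t - u, divided by (t + 1)(u + 1),
  and all factors except t - u are units.\<close>

lemma moebius_dist:
  assumes "padic_norm (t - t0) \<le> \<rho>" "padic_norm (u - t0) \<le> \<rho>"
  shows "padic_norm (potts_moebius q \<theta> t - potts_moebius q \<theta> u) = padic_norm (t - u)"
proof -
  have n: "padic_norm (t + 1) = 1" "padic_norm (u + 1) = 1" using assms by (auto intro: norm_plus_1)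
  hence "t + 1 \<noteq> 0" "u + 1 \<noteq> 0" by auto
  hence "potts_moebius q \<theta> t - potts_moebius q \<theta> u =
      (\<theta> - 1 + of_int q) * (t - u) / ((t + 1) * (u + 1))"
    unfolding potts_moebius_def by (subst diff_frac_eq) (simp_all add: algebra_simps)
  thus ?thesis using n det_norm by (simp add: padic_norm_divide padic_norm_mult)
qed

lemma moebius_near:
  assumes "padic_norm (t - t0) \<le> \<rho>"
  shows "padic_norm (potts_moebius q \<theta> t - y) \<le> \<rho>"
proof -
  have "padic_norm (potts_moebius q \<theta> t - potts_moebius q \<theta> t0) \<le> \<rho>"
    using moebius_dist[OF assms, of t0] \<rho>_pos assms by simp
  thus ?thesis using t0(2) padic_norm_trans unfolding \<rho>_def by blast
qed

lemma moebius_surj: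
  assumes w: "padic_norm (w - y) \<le> \<rho>"
  obtains t where "padic_norm (t - t0) \<le> \<rho>" "potts_moebius q \<theta> t = w"
proof -
  define D :: "'p padic" where "D = \<theta> - 1 + of_int q"
  define e where "e = w - potts_moebius q \<theta> t0"
  have "padic_norm (potts_moebius q \<theta> t0 - y) \<le> \<rho>" using t0(2) by (simp add: \<rho>_def)
  hence "padic_norm (y - potts_moebius q \<theta> t0) \<le> \<rho>" by (simp only: padic_norm_minus_commute)
  with w have e: "padic_norm e \<le> \<rho>"
    unfolding e_def by (rule padic_norm_trans)
  have "padic_norm ((D - e * (t0 + 1)) - D) < padic_norm D"
    using e \<rho>_less t0(1) det_norm by (simp add: D_def padic_norm_mult)
  hence De: "padic_norm (D - e * (t0 + 1)) = 1"
    using padic_norm_dominant det_norm unfolding D_def by metis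
  hence De0: "D - e * (t0 + 1) \<noteq> 0" by auto
  have t10: "t0 + 1 \<noteq> 0" using t0(1) by auto
  \<comment> \<open>The equation D \<delta> = e (t0 + \<delta> + 1)(t0 + 1), expressing that the
    Moebius value changes by e, is linear in \<delta>; this is its solution. The denominator is a
    unit because |e| < 1.\<close>
  define \<delta> where "\<delta> = e * (t0 + 1)\<^sup>2 / (D - e * (t0 + 1))"
  have d: "padic_norm (t0 + \<delta> - t0) \<le> \<rho>"
    using e De t0(1) by (simp add: \<delta>_def padic_norm_divide padic_norm_mult padic_norm_power)
  have "padic_norm (t0 + \<delta> + 1) = 1" using d by (rule norm_plus_1)
  hence nz: "t0 + \<delta> + 1 \<noteq> 0" by auto
  have "\<delta> * (D - e * (t0 + 1)) = e * (t0 + 1)\<^sup>2"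
    using De0 by (simp add: \<delta>_def)
  hence "D * \<delta> = e * ((t0 + \<delta> + 1) * (t0 + 1))"
    by (simp add: algebra_simps power2_eq_square)
  moreover have "potts_moebius q \<theta> (t0 + \<delta>) - potts_moebius q \<theta> t0 = D * \<delta> / ((t0 + \<delta> + 1) * (t0 + 1))"
    unfolding potts_moebius_def D_def using t10 nz by (subst diff_frac_eq) (simp_all add: algebra_simps)
  ultimately have "potts_moebius q \<theta> (t0 + \<delta>) - potts_moebius q \<theta> t0 = e"
    using t10 nz by simp
  hence "potts_moebius q \<theta> (t0 + \<delta>) = w" by (simp add: e_def)
  with d show ?thesis by (rule that)
qed

section \<open>Expansion and image of a branch in the original coordinate\<close>

definition branch_ball :: "'p padic set" where
  "branch_ball = cball (1 - of_int q + (\<theta> - 1) * t0) (\<rho> * padic_norm (\<theta> - 1))"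

text \<open>The norm of the derivative: |k y^(k-1)| from the power map, 1 from the Moebius map,
  1/|theta - 1| from the change of coordinate.\<close>

definition expansion :: real where
  "expansion = padic_norm (of_nat k :: 'p padic) * padic_norm y ^ (k - 1) / padic_norm (\<theta> - 1)"

lemma branch_ball_rescaled:
  "1 - of_int q + (\<theta> - 1) * t \<in> branch_ball \<longleftrightarrow> padic_norm (t - t0) \<le> \<rho>"
proof -
  have "dist (1 - of_int q + (\<theta> - 1) * t0) (1 - of_int q + (\<theta> - 1) * t) =
      padic_norm ((\<theta> - 1) * (t0 - t))"
    by (simp add: dist_padic_def algebra_simps)
  thus ?thesis using \<theta>(2)
    by (simp add: branch_ball_def padic_norm_mult padic_norm_minus_commute[of t0] mult.commute)
qed

lemma branch_ballE:
  assumes "x \<in> branch_ball"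
  obtains t where "x = 1 - of_int q + (\<theta> - 1) * t" "padic_norm (t - t0) \<le> \<rho>"
proof -
  have "x = 1 - of_int q + (\<theta> - 1) * ((x - 1 + of_int q) / (\<theta> - 1))"
    using \<theta>(2) by (simp add: field_simps)
  thus ?thesis using that assms branch_ball_rescaled by metis
qed

lemma branch_expand:
  assumes "x \<in> branch_ball" "x' \<in> branch_ball"
  shows "dist (potts_bethe k q \<theta> x) (potts_bethe k q \<theta> x') = expansion * dist x x'"
proof -
  obtain t where t: "x = 1 - of_int q + (\<theta> - 1) * t" "padic_norm (t - t0) \<le> \<rho>"
    using assms(1) by (rule branch_ballE)
  obtain u where u: "x' = 1 - of_int q + (\<theta> - 1) * u" "padic_norm (u - t0) \<le> \<rho>"
    using assms(2) by (rule branch_ballE)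
  have "dist x x' = padic_norm ((\<theta> - 1) * (t - u))"
    by (simp add: dist_padic_def t(1) u(1) algebra_simps)
  hence "padic_norm (t - u) = dist x x' / padic_norm (\<theta> - 1)"
    using \<theta>(2) by (simp add: padic_norm_mult)
  moreover have "dist (potts_bethe k q \<theta> x) (potts_bethe k q \<theta> x') =
      padic_norm (of_nat k :: 'p padic) * padic_norm y ^ (k - 1) * padic_norm (t - u)"
    unfolding dist_padic_def t(1) u(1) potts_bethe_rescaled[OF \<theta>(2)]
    using padic_power_dist[OF p3 k y(1)] moebius_near t(2) u(2) moebius_dist
    unfolding \<rho>_def by metis
  ultimately show ?thesis by (simp add: expansion_def)
qed

text \<open>Surjectivity of the power map near y followed by that of the Moebius map near t0. The
  ball is centred at y^k = 1 - q, hence at the same point for all branches.\<close>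

lemma branch_image:
  "cball (1 - of_int q) (padic_norm (of_nat k :: 'p padic) * padic_norm y ^ k / real CARD('p))
     \<subseteq> potts_bethe k q \<theta> ` branch_ball"
proof
  fix v :: "'p padic"
  assume "v \<in> cball (1 - of_int q) (padic_norm (of_nat k :: 'p padic) * padic_norm y ^ k / real CARD('p))"
  hence "padic_norm (v - y ^ k) \<le> padic_norm (of_nat k :: 'p padic) * padic_norm y ^ k / real CARD('p)"
    by (simp add: y(3) dist_padic_def padic_norm_minus_commute[of v])
  then obtain w where w: "padic_norm (w - y) \<le> \<rho>" "w ^ k = v"
    unfolding \<rho>_def by (rule padic_power_surj[OF p3 k y(1)])
  obtain t where t: "padic_norm (t - t0) \<le> \<rho>" "potts_moebius q \<theta> t = w"
    using w(1) by (rule moebius_surj)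
  have "v = potts_bethe k q \<theta> (1 - of_int q + (\<theta> - 1) * t)"
    using t(2) w(2) by (simp add: potts_bethe_rescaled[OF \<theta>(2)])
  thus "v \<in> potts_bethe k q \<theta> ` branch_ball" using t(1) branch_ball_rescaled by blast
qed

end

section \<open>Rescaled centres and solutions of the congruence\<close>

definition scaled_center :: "int \<Rightarrow> nat \<Rightarrow> nat \<Rightarrow> int \<Rightarrow> int \<Rightarrow> 'p::prime_card padic" where
  "scaled_center q m s x e =
     (if s = 0 then (if [x + q - 1 = 0] (mod int CARD('p)) then 0 else of_int e)
      else of_int (int CARD('p) ^ m * x))"

lemma potts_center_scaled:
  "potts_center q k s \<theta> x e = 1 - of_int q + (\<theta> - 1) * scaled_center q (s div k) s x e"
  by (simp add: potts_center_def scaled_center_def)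

lemma cong_int_padic_norm:
  "[a = b] (mod int CARD('p::prime_card) ^ n) \<longleftrightarrow>
     padic_norm (of_int a - of_int b :: 'p padic) \<le> 1 / real CARD('p) ^ n"
  using padic_norm_of_int_le_iff[of "a - b" n, where 'p='p] by (simp add: cong_iff_dvd_diff)

text \<open>For s = 0 the congruence for e says that the numerator of g(t) - x vanishes modulo p.
  For s > 0 the centre is z itself, and g(z) - z has numerator (theta - 1) z + (1 - q) - z^2, each
  term of which has norm at most p^(-m-1).\<close>

lemma scaled_center_properties:
  fixes \<theta> :: "'p::prime_card padic" and x e q :: int
  assumes \<theta>: "padic_norm (\<theta> - 1) \<le> 1 / real CARD('p)"
    and q: "padic_norm (of_int q :: 'p padic) = 1"
    and qs: "padic_norm (1 - of_int q :: 'p padic) = 1 / real CARD('p) ^ s"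
    and s: "s = m * k" and k0: "k > 0" and k: "s > 0 \<Longrightarrow> k \<ge> 2"
    and e: "s = 0 \<Longrightarrow> \<not> [x + q - 1 = 0] (mod int CARD('p)) \<Longrightarrow>
        [e * (x - 1) + x + q - 1 = 0] (mod int CARD('p))"
  defines "t \<equiv> scaled_center q m s x e" and "z \<equiv> of_int (int CARD('p) ^ m * x)"
  shows "padic_norm t \<le> 1 / real CARD('p) ^ m"
    and "padic_norm (t + 1) = 1"
    and "padic_norm (potts_moebius q \<theta> t - z) \<le> 1 / real CARD('p) ^ m / real CARD('p)"
proof -
  define P where "P = real CARD('p)"
  have P: "P > 1" using one_less_prime_card[where 'p='p] by (simp add: P_def)
  have nz: "padic_norm z \<le> 1 / P ^ m"
    using padic_norm_of_int_le_iff[of "int CARD('p) ^ m * x" m, where 'p='p] by (simp add: z_def P_def)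
  have \<theta>P: "padic_norm (\<theta> - 1) \<le> 1 / P" using \<theta> by (simp add: P_def)
  have "padic_norm t \<le> 1 / P ^ m \<and> padic_norm (t + 1) = 1 \<and>
      padic_norm (potts_moebius q \<theta> t - z) \<le> 1 / P ^ m / P"
  proof (cases "s = 0")
    case True
    hence m: "1 / P ^ m = 1" using s k0 by simp
    \<comment> \<open>Merges both kinds of centre: for d = 0 the congruence below is the case
      condition itself.\<close>
    define d :: int where "d = (if [x + q - 1 = 0] (mod int CARD('p)) then 0 else e)"
    have t: "t = of_int d" using True by (simp add: t_def scaled_center_def d_def)
    have "[d * (x - 1) + x + q - 1 = 0] (mod int CARD('p))"
      using e True by (auto simp: d_def)
    hence d: "padic_norm (of_int (d * (x - 1) + x + q - 1) :: 'p padic) \<le> 1 / P"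
      using cong_int_padic_norm[of "d * (x - 1) + x + q - 1" 0 1, where 'p='p] by (simp add: P_def)
    \<comment> \<open>If p divided d + 1, subtracting (d + 1)(x - 1) from the congruence would leave
      p dividing q.\<close>
    have "padic_norm (of_int (d + 1) :: 'p padic) = 1"
    proof (rule ccontr)
      assume "padic_norm (of_int (d + 1) :: 'p padic) \<noteq> 1"
      hence "int CARD('p) dvd d + 1" by (simp only: padic_norm_of_int_eq_1_iff not_not)
      hence "int CARD('p) dvd (d + 1) * (x - 1)" by (rule dvd_mult2)
      moreover have "int CARD('p) dvd d * (x - 1) + x + q - 1"
        using \<open>[d * (x - 1) + x + q - 1 = 0] (mod int CARD('p))\<close> by (simp add: cong_0_iff)
      ultimately have "int CARD('p) dvd (d * (x - 1) + x + q - 1) - (d + 1) * (x - 1)"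
        by (rule dvd_diff[rotated])
      hence "int CARD('p) dvd q" by (simp add: algebra_simps)
      thus False using q padic_norm_of_int_eq_1_iff[of q, where 'p='p] by simp
    qed
    hence t1: "padic_norm (t + 1) = 1" by (simp add: t)
    hence "t + 1 \<noteq> 0" by auto
    moreover have z: "z = of_int x" using True s k0 by (simp add: z_def)
    ultimately have "potts_moebius q \<theta> t - z =
        ((\<theta> - 1) * t - of_int (d * (x - 1) + x + q - 1)) / (t + 1)"
      unfolding potts_moebius_def t z by (simp add: field_simps)
    moreover have "padic_norm ((\<theta> - 1) * t) \<le> 1 / P"
      using \<theta>P padic_norm_of_int_le_1[of d, where 'a='p]
      by (simp add: padic_norm_mult t) (meson mult_left_le order_trans padic_norm_nonneg)
    ultimately have "padic_norm (potts_moebius q \<theta> t - z) \<le> 1 / P"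
      using t1 padic_norm_diff_le[OF _ d] by (simp add: padic_norm_divide)
    thus ?thesis using t1 m by (simp add: t padic_norm_of_int_le_1)
  next
    case False
    hence t: "t = z" by (simp add: t_def scaled_center_def z_def)
    have k2: "k \<ge> 2" and m1: "m \<ge> 1" using False k s by auto
    have Pm: "1 / P ^ m \<le> 1 / P"
      using power_increasing[OF m1, of P] P by (simp add: frac_le)
    moreover have "1 / P < 1" using P by simp
    ultimately have Pm1: "1 / P ^ m < 1" by linarith
    have "padic_norm ((z + 1) - 1) < padic_norm (1 :: 'p padic)" using nz Pm1 by simp
    hence t1: "padic_norm (z + 1) = 1" using padic_norm_dominant by fastforce
    hence z1: "z + 1 \<noteq> 0" by auto
    have "potts_moebius q \<theta> z - z = ((\<theta> - 1) * z + ((1 - of_int q) - z * z)) / (z + 1)"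
      unfolding potts_moebius_def using z1 by (simp add: field_simps)
    moreover have "padic_norm ((\<theta> - 1) * z) \<le> 1 / P ^ m / P"
      using mult_mono[OF \<theta>P nz] P by (simp add: padic_norm_mult mult.commute)
    moreover have "padic_norm (z * z) \<le> 1 / P ^ m / P"
      using mult_mono[OF nz order_trans[OF nz Pm]] P by (simp add: padic_norm_mult)
    moreover have "padic_norm (1 - of_int q :: 'p padic) \<le> 1 / P ^ m / P"
    proof -
      \<comment> \<open>Here k >= 2 is used: s = m k must exceed m for 1 - q to be
        negligible.\<close>
      have "m + 1 \<le> s" using mult_le_mono2[OF k2, of m] m1 unfolding s by linarith
      hence "P ^ (m + 1) \<le> P ^ s" using P by (intro power_increasing) auto
      thus ?thesis unfolding qs P_def[symmetric] using P by (simp add: frac_le mult.commute)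
    qed
    ultimately have "padic_norm (potts_moebius q \<theta> z - z) \<le> 1 / P ^ m / P"
      using t1 by (simp add: padic_norm_divide padic_norm_add_le padic_norm_diff_le)
    thus ?thesis using t t1 nz by simp
  qed
  thus "padic_norm t \<le> 1 / real CARD('p) ^ m" "padic_norm (t + 1) = 1"
    "padic_norm (potts_moebius q \<theta> t - z) \<le> 1 / real CARD('p) ^ m / real CARD('p)"
    by (simp_all add: P_def)
qed

text \<open>The congruence holds modulo p^(s+1) while |1 - q| is exactly p^(-s). Hence z^k and 1 - q
  have equal norm, and extracting a k-th root gives |z|.\<close>

lemma Sol_norm:
  assumes "x \<in> Sol CARD('p::prime_card) k q (m * k)" "k > 0"
    and q: "padic_norm (1 - of_int q :: 'p padic) = 1 / real CARD('p) ^ (m * k)"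
  defines "z \<equiv> of_int (int CARD('p) ^ m * x) :: 'p padic"
  shows "padic_norm z = 1 / real CARD('p) ^ m"
    and "padic_norm (z ^ k - (1 - of_int q)) \<le> (1 / real CARD('p) ^ m) ^ k / real CARD('p)"
proof -
  define P where "P = real CARD('p)"
  have P: "P > 1" using one_less_prime_card[where 'p='p] by (simp add: P_def)
  have "[(int CARD('p) ^ m * x) ^ k + q - 1 = 0] (mod int CARD('p) ^ (m * k + 1))"
    using assms(1,2) by (simp add: Sol_def)
  hence "padic_norm (of_int ((int CARD('p) ^ m * x) ^ k + q - 1) :: 'p padic) \<le> 1 / P ^ (m * k + 1)"
    using iffD1[OF cong_int_padic_norm[of _ 0 "m * k + 1", where 'p='p]]
    unfolding P_def of_int_0 diff_zero by blast
  also have "of_int ((int CARD('p) ^ m * x) ^ k + q - 1) = z ^ k - (1 - of_int q)"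
    by (simp add: z_def)
  finally have near: "padic_norm (z ^ k - (1 - of_int q)) \<le> 1 / P ^ (m * k + 1)" .
  thus "padic_norm (z ^ k - (1 - of_int q)) \<le> (1 / real CARD('p) ^ m) ^ k / real CARD('p)"
    by (simp add: P_def power_one_over mult.commute flip: power_mult)
  have "padic_norm (z ^ k) = padic_norm (1 - of_int q :: 'p padic)"
    using near q P by (intro padic_norm_near) (auto simp: P_def mult.commute)
  hence "padic_norm z ^ k = (1 / P ^ m) ^ k"
    using q by (simp add: padic_norm_power P_def power_mult power_one_over)
  thus "padic_norm z = 1 / real CARD('p) ^ m"
    using assms(2) P by (subst (asm) power_eq_iff_eq_base) (auto simp: P_def)
qed

lemma Sol_eqI:
  assumes "x \<in> Sol CARD('p::prime_card) k q s" "x' \<in> Sol CARD('p) k q s"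
    and near: "padic_norm (of_int (int CARD('p) ^ m * x) - of_int (int CARD('p) ^ m * x') :: 'p padic)
      \<le> 1 / real CARD('p) ^ m / real CARD('p)"
  shows "x = x'"
proof -
  have "padic_norm (of_int (int CARD('p) ^ m * (x - x')) :: 'p padic) \<le> 1 / real CARD('p) ^ (m + 1)"
    using near by (simp add: algebra_simps)
  hence "int CARD('p) ^ m * int CARD('p) dvd int CARD('p) ^ m * (x - x')"
    by (subst (asm) padic_norm_of_int_le_iff) (simp add: mult.commute)
  hence "[x = x'] (mod int CARD('p))" by (simp add: cong_iff_dvd_diff)
  moreover have "0 \<le> x" "x < int CARD('p)" "0 \<le> x'" "x' < int CARD('p)"
    using assms(1,2) by (auto simp: Sol_def split: if_splits)
  ultimately show ?thesis using cong_less_imp_eq_int by blast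
qed

section \<open>The conjugacy for the Potts-Bethe mapping\<close>

theorem theorem1p1:
  fixes \<theta> :: "'p::prime_card padic" and k s :: nat and q :: int
    and \<kappa> :: nat and \<xi> \<eta> :: "nat \<Rightarrow> int"
  defines "p \<equiv> CARD('p)"
  defines "f \<equiv> potts_bethe k q \<theta>"
  defines "X \<equiv> potts_X q k s \<theta> \<kappa> \<xi> \<eta>"
  defines "J \<equiv> julia_set f X"
  assumes "p \<ge> 3" and "k \<ge> 1" and "q \<ge> 2"
    and "padic_norm (of_int q :: 'p padic) = 1"
    and "padic_norm (of_int q - 1 :: 'p padic) = real p powi (- int s)"
    and "\<theta> \<in> padic_E" and "\<theta> \<noteq> 1"
    and "\<exists>y :: 'p padic. y ^ k = 1 - of_int q"
    and "\<kappa> = card (Sol p k q s)" and "\<kappa> \<ge> 2"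
    and "bij_betw \<xi> {1..\<kappa>} (Sol p k q s)"
    and "\<And>i. i \<in> {1..\<kappa>} \<Longrightarrow> s = 0 \<Longrightarrow> \<not> [\<xi> i + q - 1 = 0] (mod int p) \<Longrightarrow>
           [\<eta> i * (\<xi> i - 1) + \<xi> i + q - 1 = 0] (mod int p)"
    and "padic_norm (of_nat k :: 'p padic) >
           real p powr (real s * (real k - 1) / real k) * padic_norm (\<theta> - 1)"
  shows "\<exists>h. homeomorphic_map (top_of_set J) (full_shift_space \<kappa>) h \<and>
             (\<forall>x\<in>J. h (f x) = left_shift (h x))"
proof -
  note p3 = assms(5)[unfolded p_def] and q1 = assms(8) and \<theta>1 = assms(11)
    and bij = assms(15)[unfolded p_def]
  have k: "k > 0" using assms(6) by simp
  define P where "P = real CARD('p)"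
  have P: "P > 1" using one_less_prime_card[where 'p='p] by (simp add: P_def)
  have \<theta>P: "padic_norm (\<theta> - 1) \<le> 1 / P" using assms(10) by (simp add: padic_E_def P_def)
  \<comment> \<open>Otherwise the solution set would be empty by definition, contradicting \<kappa>
    >= 2.\<close>
  have "k dvd s" using assms(13,14) by (auto simp: Sol_def split: if_splits)
  then obtain m where m: "s = m * k" by (metis dvd_def mult.commute)
  have sk: "s div k = m" using k by (simp add: m)
  define \<beta> where "\<beta> = 1 / P ^ m"
  have \<beta>: "\<beta> > 0" "\<beta> \<le> 1" using P by (auto simp: \<beta>_def)
  have qs: "padic_norm (1 - of_int q :: 'p padic) = 1 / P ^ s"
    using assms(9) by (simp add: padic_norm_minus_commute[of 1] p_def P_def power_int_minus divide_inverse)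
  have qk: "padic_norm (1 - of_int q :: 'p padic) = \<beta> ^ k"
    unfolding qs by (simp add: \<beta>_def m power_mult power_one_over)
  have \<xi>_Sol: "\<xi> i \<in> Sol CARD('p) k q s" if "i \<in> {1..\<kappa>}" for i
    using bij that by (auto simp: bij_betw_def)
  define z :: "nat \<Rightarrow> 'p padic" where "z i = of_int (int CARD('p) ^ m * \<xi> i)" for i
  have sep: "i = j" if "i \<in> {1..\<kappa>}" "j \<in> {1..\<kappa>}" "padic_norm (z i - z j) \<le> \<beta> / P" for i j
  proof -
    have "\<xi> i = \<xi> j"
      using Sol_eqI[OF \<xi>_Sol \<xi>_Sol] that unfolding z_def \<beta>_def P_def by blast
    thus ?thesis using bij that(1,2) by (auto simp: bij_betw_def dest: inj_onD)
  qed
  have z: "padic_norm (z i) = \<beta>" "padic_norm (z i ^ k - (1 - of_int q)) \<le> \<beta> ^ k / P"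
    if "i \<in> {1..\<kappa>}" for i
    using Sol_norm[OF \<xi>_Sol[OF that, unfolded m] k] qs that unfolding m z_def \<beta>_def P_def by blast+
  \<comment> \<open>For k = 1 all z i agree with 1 - q modulo p^(s+1), so there could not be two
    distinct solutions.\<close>
  have k2: "k \<ge> 2" if "s > 0"
  proof (rule ccontr)
    assume "\<not> k \<ge> 2"
    hence "k = 1" using k by simp
    have "padic_norm (z 1 - z 2) \<le> \<beta> / P"
      using z(2)[of 1] z(2)[of 2] \<open>\<kappa> \<ge> 2\<close> padic_norm_trans[of "z 1" "1 - of_int q" "\<beta> / P" "z 2"]
      by (simp add: \<open>k = 1\<close> padic_norm_minus_commute[of "1 - of_int q"])
    thus False using sep[of 1 2] \<open>\<kappa> \<ge> 2\<close> by simp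
  qed
  obtain y where y: "y ^ k = (1 - of_int q :: 'p padic)" using assms(12) by blast
  have "padic_norm y ^ k = \<beta> ^ k" using qk by (simp flip: y add: padic_norm_power)
  hence ny: "padic_norm y = \<beta>" using k \<beta> by (subst (asm) power_eq_iff_eq_base) auto
  hence y0: "y \<noteq> 0" using \<beta> by auto
  \<comment> \<open>One given root y provides a root near every z i, after multiplication by a
    suitable root of unity.\<close>
  have "\<exists>w. padic_norm (w - z i) \<le> \<beta> / P \<and> w ^ k = 1 - of_int q" if "i \<in> {1..\<kappa>}" for i
    using padic_root_near[OF p3 y0, of "z i" k] z[OF that] y ny by (metis P_def)
  then obtain w where w: "\<And>i. i \<in> {1..\<kappa>} \<Longrightarrow> padic_norm (w i - z i) \<le> \<beta> / P"
    "\<And>i. i \<in> {1..\<kappa>} \<Longrightarrow> w i ^ k = 1 - of_int q" by metis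
  have nw: "padic_norm (w i) = \<beta>" if "i \<in> {1..\<kappa>}" for i
    using padic_norm_near[of "w i" "z i"] w(1)[OF that] z(1)[OF that] \<beta>(1) by (auto simp: P_def)
  define t :: "nat \<Rightarrow> 'p padic" where "t i = scaled_center q m s (\<xi> i) (\<eta> i)" for i
  have t: "padic_norm (t i) \<le> \<beta>" "padic_norm (t i + 1) = 1"
      "padic_norm (potts_moebius q \<theta> (t i) - z i) \<le> \<beta> / P" if i: "i \<in> {1..\<kappa>}" for i
    using scaled_center_properties[OF \<theta>P[unfolded P_def] q1 qs[unfolded P_def] m k k2
        assms(16)[OF i, unfolded p_def]]
    unfolding t_def z_def \<beta>_def P_def by blast+
  have branch: "potts_branch \<theta> q k (w i) (t i)" if i: "i \<in> {1..\<kappa>}" for i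
  proof
    show "padic_norm (potts_moebius q \<theta> (t i) - w i) \<le> padic_norm (w i) / real CARD('p)"
      using padic_norm_trans[OF t(3)[OF i], of "w i"] w(1)[OF i]
      by (simp add: nw[OF i] P_def padic_norm_minus_commute[of "z i"])
    show "w i \<noteq> 0" using nw[OF i] \<beta> by auto
  qed (use p3 k q1 \<theta>P \<theta>1 w(2)[OF i] nw[OF i] \<beta> t(2)[OF i] in \<open>auto simp: P_def\<close>)
  define r where "r = \<beta> / P * padic_norm (\<theta> - 1)"
  define B where "B i = cball (1 - of_int q + (\<theta> - 1) * t i) r" for i
  have B: "B i = potts_branch.branch_ball \<theta> q (w i) (t i)" if i: "i \<in> {1..\<kappa>}" for i
    unfolding potts_branch.branch_ball_def[OF branch[OF i]] potts_branch.\<rho>_def[OF branch[OF i]]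
    by (simp add: B_def r_def nw[OF i] P_def)
  define lam where "lam = padic_norm (of_nat k :: 'p padic) * \<beta> ^ (k - 1) / padic_norm (\<theta> - 1)"
  have lam: "lam = potts_branch.expansion \<theta> k (w i)" if i: "i \<in> {1..\<kappa>}" for i
    unfolding potts_branch.expansion_def[OF branch[OF i]] by (simp add: lam_def nw[OF i])
  \<comment> \<open>As s = m k, the exponent in the hypothesis is an integer, and the hypothesis
    amounts to \<open>lam\<close> > 1.\<close>
  have "real s * (real k - 1) / real k = real (m * (k - 1))"
    using k by (simp add: m of_nat_diff)
  hence "P ^ (m * (k - 1)) * padic_norm (\<theta> - 1) < padic_norm (of_nat k :: 'p padic)"
    using assms(17) P unfolding p_def \<open>_ = real (m * (k - 1))\<close> P_def[symmetric]
    by (subst (asm) powr_realpow) simp_all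
  hence less: "padic_norm (\<theta> - 1) < padic_norm (of_nat k :: 'p padic) * \<beta> ^ (k - 1)"
    using P by (simp add: \<beta>_def power_mult power_one_over field_simps)
  have radius: "potts_radius k s \<theta> = r"
  proof -
    have "real (s + k) / real k = real (m + 1)" using k by (simp add: m field_simps)
    hence "real CARD('p) powr - (real (s + k) / real k) = inverse (P powr real (m + 1))"
      by (simp only: P_def powr_minus)
    also have "\<dots> = inverse (P ^ (m + 1))"
      using P by (subst powr_realpow) simp_all
    also have "\<dots> = \<beta> / P" by (simp add: \<beta>_def divide_inverse)
    finally show ?thesis by (simp add: potts_radius_def r_def)
  qed
  have X: "X = (\<Union>i\<in>{1..\<kappa>}. B i)"
    unfolding X_def potts_X_def B_def radius potts_center_scaled sk t_def ..
  have "full_branches f B \<kappa> lam (2 * r)"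
  proof
    show "lam > 1" using less \<theta>1 by (simp add: lam_def)
    show "closed (B i)" for i by (simp add: B_def)
    have "r \<ge> 0"
      unfolding r_def using \<beta> P by (intro mult_nonneg_nonneg divide_nonneg_nonneg) auto
    thus "B i \<noteq> {}" for i by (simp add: B_def not_less)
    show "dist x y \<le> 2 * r" if "x \<in> B i" "y \<in> B i" for i x y
      using that dist_triangle2[of x y "1 - of_int q + (\<theta> - 1) * t i"]
      by (simp add: B_def dist_commute)
    show "dist (f x) (f y) = lam * dist x y" if "i \<in> {1..\<kappa>}" "x \<in> B i" "y \<in> B i" for i x y
      using potts_branch.branch_expand[OF branch] that B lam unfolding f_def by metis
    show "B i \<inter> B j = {}" if ij: "i \<in> {1..\<kappa>}" "j \<in> {1..\<kappa>}" "i \<noteq> j" for i j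
    proof (rule ccontr)
      assume "B i \<inter> B j \<noteq> {}"
      \<comment> \<open>In the rescaled coordinate a common point has a Moebius image within
        \<beta>/P of both z i and z j, which \<open>sep\<close> excludes.\<close>
      then obtain x where x: "x \<in> B i" "x \<in> B j" by blast
      obtain u where u: "x = 1 - of_int q + (\<theta> - 1) * u" "padic_norm (u - t i) \<le> potts_branch.\<rho> (w i)"
        using potts_branch.branch_ballE[OF branch[OF ij(1)]] x(1) B[OF ij(1)] by blast
      have u': "padic_norm (u - t j) \<le> potts_branch.\<rho> (w j)"
        using potts_branch.branch_ball_rescaled[OF branch[OF ij(2)]] x(2) B[OF ij(2)] u(1) by blast
      have \<rho>: "potts_branch.\<rho> (w l) = \<beta> / P" if "l \<in> {1..\<kappa>}" for l
        using potts_branch.\<rho>_def[OF branch[OF that]] nw[OF that] by (simp add: P_def)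
      have near: "padic_norm (potts_moebius q \<theta> u - z l) \<le> \<beta> / P"
        if l: "l \<in> {1..\<kappa>}" and "padic_norm (u - t l) \<le> potts_branch.\<rho> (w l)" for l
        using padic_norm_trans[of "potts_moebius q \<theta> u" "w l" "\<beta> / P" "z l"]
          potts_branch.moebius_near[OF branch[OF l] that(2)] w(1)[OF l] \<rho>[OF l] by simp
      have "padic_norm (z i - z j) \<le> \<beta> / P"
        using padic_norm_trans[of "z i" "potts_moebius q \<theta> u" "\<beta> / P" "z j"]
          near[OF ij(1) u(2)] near[OF ij(2) u'] by (simp add: padic_norm_minus_commute[of "z i"])
      thus False using sep ij by blast
    qed
    show "B j \<subseteq> f ` B i" if ij: "i \<in> {1..\<kappa>}" "j \<in> {1..\<kappa>}" for i j
    proof -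
      \<comment> \<open>Points of X have the form 1 - q + (theta - 1) u with |u| <= \<beta>, so X
        lies near 1 - q, the common centre of all branch images.\<close>
      have "B j \<subseteq> cball (1 - of_int q) (padic_norm (of_nat k :: 'p padic) * padic_norm (w i) ^ k / real CARD('p))"
      proof
        fix x assume "x \<in> B j"
        then obtain u where u: "x = 1 - of_int q + (\<theta> - 1) * u" "padic_norm (u - t j) \<le> potts_branch.\<rho> (w j)"
          using potts_branch.branch_ballE[OF branch[OF ij(2)]] B[OF ij(2)] by blast
        have "\<beta> / P \<le> \<beta>" using P \<beta> by (simp add: divide_le_eq)
        hence "potts_branch.\<rho> (w j) \<le> \<beta>"
          using potts_branch.\<rho>_def[OF branch[OF ij(2)]] nw[OF ij(2)] by (simp add: P_def)
        hence "padic_norm u \<le> \<beta>"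
          using padic_norm_add_le[of "u - t j" \<beta> "t j"] u(2) t(1)[OF ij(2)] by simp
        \<comment> \<open>Discreteness sharpens the strict inequality by a factor p. The element k
          y^(k-1) is used because its norm is the right-hand side before division by P.\<close>
        have "padic_norm (\<theta> - 1) \<le> padic_norm (of_nat k :: 'p padic) * \<beta> ^ (k - 1) / P"
          using padic_norm_less_imp[of "\<theta> - 1" "of_nat k * y ^ (k - 1)"] less
          by (simp add: padic_norm_mult padic_norm_power ny P_def)
        hence "padic_norm (\<theta> - 1) * padic_norm u \<le>
            padic_norm (of_nat k :: 'p padic) * \<beta> ^ (k - 1) / P * \<beta>"
          using \<open>padic_norm u \<le> \<beta>\<close> P \<beta> by (intro mult_mono) auto
        also have "\<dots> = padic_norm (of_nat k :: 'p padic) * \<beta> ^ k / P"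
          using k by (simp add: power_eq_if)
        finally have "dist (1 - of_int q) x \<le> padic_norm (of_nat k :: 'p padic) * \<beta> ^ k / P"
          by (simp add: dist_padic_def u(1) flip: padic_norm_mult)
        thus "x \<in> cball (1 - of_int q) (padic_norm (of_nat k :: 'p padic) * padic_norm (w i) ^ k / real CARD('p))"
          by (simp add: nw[OF ij(1)] P_def)
      qed
      thus ?thesis using potts_branch.branch_image[OF branch[OF ij(1)]] B[OF ij(1)]
        unfolding f_def by blast
    qed
  qed
  thus ?thesis unfolding J_def X by (rule full_branches.conjugate_to_full_shift)
qed

end
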